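(* Let $T$ be a finite tree. Then $T \in \mathcal{T}$ if and only if $T$ has a $(\gamma_t-\tau)$-set, where $\mathcal{T}$ is the family of trees constructed from the path $P_4$ by the operations $\mathcal{O}_1,\mathcal{O}_2,\mathcal{O}_3,\mathcal{O}_4$ defined in the context.
   Context: All graphs are finite, undirected, simple and connected. $N(v)$ is the set of neighbors of $v$ (so $v\notin N(v)$). $P_n$ is the path with $n$ vertices. An end vertex (leaf) is a vertex of degree 1; a support vertex is a neighbor of an end vertex. A vertex cover of $G=(V,E)$ is a set $X\subseteq V$ such that each edge is incident to at least one vertex of $X$; $\tau(G)$ is the minimum cardinality of a vertex cover, and a $\tau(G)$-set is a vertex cover of cardinality $\tau(G)$. A total dominating set of $G$ is a dominating set $D\subseteq V$ such that the subgraph induced by $D$ has no isolated vertices (equivalently, every vertex of $G$ has a neighbor in $D$); $\gamma_t(G)$ is the minimum cardinality of a total dominating set (defined for graphs without isolated vertices), and a $\gamma_t(G)$-set is a total dominating set of cardinality $\gamma_t(G)$. A $(\gamma_t-\tau)$-set of $G$ is a set that is both a $\gamma_t(G)$-set and a $\tau(G)$-set. For $S\subseteq V$ and $v\in S$, $\mathrm{pn}(v,S)=\{u\in V : N(u)\cap S=\{v\}\}$. For a $\gamma_t(G)$-set $S$, a vertex $v$ is $S$-quasi-isolated if there is $u\in S$ with $\mathrm{pn}(u,S)=\{v\}$; $v$ is quasi-isolated (in $G$) if it is $S$-quasi-isolated for some $\gamma_t(G)$-set $S$. For disjoint graphs $G,H$ with $u\in V(G)$, $v\in V(H)$, the sum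 of $G$ with $H$ via the edge $uv$, $G+_{uv}H$, has vertex set $V(G)\cup V(H)$ and edge set $E(G)\cup E(H)\cup\{uv\}$. Operations on a tree $T$: - $\mathcal{O}_1$: choose $u\in V(T)$ belonging to some $(\gamma_t-\tau)$-set of $T$; let $v$ be a leaf of a (disjoint) path $P_4$; form $T+_{uv}P_4$. - $\mathcal{O}_2$: choose $u\in V(T)$ belonging to some $(\gamma_t-\tau)$-set of $T$; add a new vertex $v$ adjacent exactly to $u$. - $\mathcal{O}_3$: choose $u\in V(T)$ belonging to some $(\gamma_t-\tau)$-set of $T$ and such that $u$ is not quasi-isolated in $T$; let $P_2=(v,w)$ be a (disjoint) path with two vertices; form $T+_{uv}P_2$. - $\mathcal{O}_4$: choose $u\in V(T)$ that is not quasi-isolated in $T$; let $v$ be a support vertex of a (disjoint) path $P_4$; form $T+_{uv}P_4$. The family $\mathcal{T}$ consists of all trees $T$ (up to isomorphism) for which there is a sequence $T_1,\dots,T_k$ ($k\ge 1$) of trees such that $T_1=P_4$, $T_k=T$, and, if $k\ge 2$, each $T_{i+1}$ is obtained from $T_i$ by one of the operations $\mathcal{O}_1,\mathcal{O}_2,\mathcal{O}_3,\mathcal{O}_4$. *)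

theory Defs
  imports Main
begin

record 'a ugraph =
  verts :: "'a set"
  edges :: "'a set set"

definition simple_graph :: "'a ugraph \<Rightarrow> bool" where
  "simple_graph G \<longleftrightarrow>
     finite (verts G) \<and> (\<forall>e\<in>edges G. e \<subseteq> verts G \<and> card e = 2)"

definition adjacent :: "'a ugraph \<Rightarrow> 'a \<Rightarrow> 'a \<Rightarrow> bool" where
  "adjacent G u v \<longleftrightarrow> {u, v} \<in> edges G"

definition neighbors :: "'a ugraph \<Rightarrow> 'a \<Rightarrow> 'a set" where
  "neighbors G v = {u \<in> verts G. adjacent G v u}"

definition degree :: "'a ugraph \<Rightarrow> 'a \<Rightarrow> nat" where
  "degree G v = card (neighbors G v)"

definition leaf :: "'a ugraph \<Rightarrow> 'a \<Rightarrow> bool" where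
  "leaf G v \<longleftrightarrow> v \<in> verts G \<and> degree G v = 1"

definition support_vertex :: "'a ugraph \<Rightarrow> 'a \<Rightarrow> bool" where
  "support_vertex G v \<longleftrightarrow> v \<in> verts G \<and> (\<exists>l. leaf G l \<and> v \<in> neighbors G l)"

definition induced_subgraph :: "'a ugraph \<Rightarrow> 'a set \<Rightarrow> 'a ugraph" where
  "induced_subgraph G S = \<lparr>verts = verts G \<inter> S, edges = {e \<in> edges G. e \<subseteq> S}\<rparr>"

definition connected_graph :: "'a ugraph \<Rightarrow> bool" where
  "connected_graph G \<longleftrightarrow>
     verts G \<noteq> {} \<and> (\<forall>u\<in>verts G. \<forall>v\<in>verts G. (adjacent G)\<^sup>*\<^sup>* u v)"

definition is_cycle :: "'a ugraph \<Rightarrow> 'a list \<Rightarrow> bool" where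
  "is_cycle G c \<longleftrightarrow>
     length c \<ge> 3 \<and> distinct c \<and> set c \<subseteq> verts G \<and>
     successively (adjacent G) c \<and> adjacent G (last c) (hd c)"

definition tree :: "'a ugraph \<Rightarrow> bool" where
  "tree G \<longleftrightarrow> simple_graph G \<and> connected_graph G \<and> \<not> (\<exists>c. is_cycle G c)"


(* Every set of n vertices carries its own copies of the path on n vertices. *)
definition is_path_graph :: "nat \<Rightarrow> 'a ugraph \<Rightarrow> bool" where
  "is_path_graph n G \<longleftrightarrow>
     (\<exists>xs. distinct xs \<and> length xs = n \<and>
        G = \<lparr>verts = set xs, edges = {{xs ! i, xs ! Suc i} | i. Suc i < n}\<rparr>)"


definition vertex_cover :: "'a ugraph \<Rightarrow> 'a set \<Rightarrow> bool" where
  "vertex_cover G X \<longleftrightarrow> X \<subseteq> verts G \<and> (\<forall>e\<in>edges G. e \<inter> X \<noteq> {})"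

definition vertex_cover_number :: "'a ugraph \<Rightarrow> nat" where
  "vertex_cover_number G = (LEAST k. \<exists>X. vertex_cover G X \<and> card X = k)"

definition tau_set :: "'a ugraph \<Rightarrow> 'a set \<Rightarrow> bool" where
  "tau_set G X \<longleftrightarrow> vertex_cover G X \<and> card X = vertex_cover_number G"

definition dominating_set :: "'a ugraph \<Rightarrow> 'a set \<Rightarrow> bool" where
  "dominating_set G D \<longleftrightarrow>
     D \<subseteq> verts G \<and> (\<forall>v \<in> verts G - D. neighbors G v \<inter> D \<noteq> {})"

definition total_dominating_set :: "'a ugraph \<Rightarrow> 'a set \<Rightarrow> bool" where
  "total_dominating_set G D \<longleftrightarrow>
     dominating_set G D \<and> (\<forall>v\<in>D. neighbors (induced_subgraph G D) v \<noteq> {})"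

lemma total_dominating_set_iff:
  "total_dominating_set G D \<longleftrightarrow>
     D \<subseteq> verts G \<and> (\<forall>v\<in>verts G. neighbors G v \<inter> D \<noteq> {})"
  unfolding total_dominating_set_def dominating_set_def induced_subgraph_def
    neighbors_def adjacent_def
  by fastforce

(* Meaningful only if G has a total dominating set; gamma_t_set is false otherwise. *)
definition total_domination_number :: "'a ugraph \<Rightarrow> nat" where
  "total_domination_number G = (LEAST k. \<exists>D. total_dominating_set G D \<and> card D = k)"

definition gamma_t_set :: "'a ugraph \<Rightarrow> 'a set \<Rightarrow> bool" where
  "gamma_t_set G D \<longleftrightarrow>
     total_dominating_set G D \<and> card D = total_domination_number G"

definition gamma_t_tau_set :: "'a ugraph \<Rightarrow> 'a set \<Rightarrow> bool" where
  "gamma_t_tau_set G S \<longleftrightarrow> gamma_t_set G S \<and> tau_set G S"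


definition private_neighbors :: "'a ugraph \<Rightarrow> 'a \<Rightarrow> 'a set \<Rightarrow> 'a set" where
  "private_neighbors G v S = {u \<in> verts G. neighbors G u \<inter> S = {v}}"

definition quasi_isolated_wrt :: "'a ugraph \<Rightarrow> 'a set \<Rightarrow> 'a \<Rightarrow> bool" where
  "quasi_isolated_wrt G S v \<longleftrightarrow> (\<exists>u\<in>S. private_neighbors G u S = {v})"

definition quasi_isolated :: "'a ugraph \<Rightarrow> 'a \<Rightarrow> bool" where
  "quasi_isolated G v \<longleftrightarrow> (\<exists>S. gamma_t_set G S \<and> quasi_isolated_wrt G S v)"


definition graph_sum :: "'a ugraph \<Rightarrow> 'a ugraph \<Rightarrow> 'a \<Rightarrow> 'a \<Rightarrow> 'a ugraph" where
  "graph_sum G H u v =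
     \<lparr>verts = verts G \<union> verts H, edges = edges G \<union> edges H \<union> {{u, v}}\<rparr>"

definition op1 :: "'a ugraph \<Rightarrow> 'a ugraph \<Rightarrow> bool" where
  "op1 T T' \<longleftrightarrow>
     (\<exists>u S P v. u \<in> verts T \<and> gamma_t_tau_set T S \<and> u \<in> S \<and>
        is_path_graph 4 P \<and> verts T \<inter> verts P = {} \<and> leaf P v \<and>
        T' = graph_sum T P u v)"

definition op2 :: "'a ugraph \<Rightarrow> 'a ugraph \<Rightarrow> bool" where
  "op2 T T' \<longleftrightarrow>
     (\<exists>u S v. u \<in> verts T \<and> gamma_t_tau_set T S \<and> u \<in> S \<and>
        v \<notin> verts T \<and>
        T' = \<lparr>verts = insert v (verts T), edges = insert {u, v} (edges T)\<rparr>)"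

definition op3 :: "'a ugraph \<Rightarrow> 'a ugraph \<Rightarrow> bool" where
  "op3 T T' \<longleftrightarrow>
     (\<exists>u S P v. u \<in> verts T \<and> gamma_t_tau_set T S \<and> u \<in> S \<and> \<not> quasi_isolated T u \<and>
        is_path_graph 2 P \<and> verts T \<inter> verts P = {} \<and> v \<in> verts P \<and>
        T' = graph_sum T P u v)"

definition op4 :: "'a ugraph \<Rightarrow> 'a ugraph \<Rightarrow> bool" where
  "op4 T T' \<longleftrightarrow>
     (\<exists>u P v. u \<in> verts T \<and> \<not> quasi_isolated T u \<and>
        is_path_graph 4 P \<and> verts T \<inter> verts P = {} \<and> support_vertex P v \<and>
        T' = graph_sum T P u v)"

(* Closure under isomorphism is built in: the first term may be any copy of the
   4-vertex path in the type 'a, and the operations may add any fresh vertices.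
   Since each term is a subgraph of the next, all vertices used lie in verts T, so a
   finite vertex type is no restriction. *)
definition tree_family :: "'a ugraph set" where
  "tree_family =
     {T. \<exists>Ts. Ts \<noteq> [] \<and> (\<forall>T'\<in>set Ts. tree T') \<and> is_path_graph 4 (hd Ts) \<and> last Ts = T \<and>
        (\<forall>i. Suc i < length Ts \<longrightarrow>
           op1 (Ts ! i) (Ts ! Suc i) \<or> op2 (Ts ! i) (Ts ! Suc i) \<or>
           op3 (Ts ! i) (Ts ! Suc i) \<or> op4 (Ts ! i) (Ts ! Suc i))}"

end

theory Submission
  imports Defs
begin

text \<open>
  A \<open>(\<gamma>\<^sub>t-\<tau>)\<close>-set \<open>S\<close> contains every support vertex and no leaf. That each operation preserves
  the existence of such a set is a comparison of minima; a vertex \<open>u\<close> is quasi-isolated iff fewer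
  than \<open>\<gamma>\<^sub>t\<close> vertices can totally dominate everything except \<open>u\<close>, which is what the last two
  operations need.

  Conversely, some operation can be undone on any tree with such an \<open>S\<close> other than \<open>P\<^sub>4\<close>. If a vertex
  has two leaves, delete one (\<open>op2\<close>). Otherwise take a longest path \<open>x\<^sub>0 x\<^sub>1 x\<^sub>2 x\<^sub>3 \<dots>\<close>; then \<open>x\<^sub>1\<close> has
  degree 2 and \<open>x\<^sub>1, x\<^sub>2 \<in> S\<close>. If \<open>x\<^sub>2\<close> has a second branch of length two, delete \<open>x\<^sub>0, x\<^sub>1\<close> (\<open>op3\<close>). If
  \<open>x\<^sub>2\<close> has a leaf, delete it together with \<open>x\<^sub>0, x\<^sub>1, x\<^sub>2\<close> (\<open>op4\<close>), unless \<open>x\<^sub>2\<close> is the only vertex of \<open>S\<close>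
  dominating \<open>x\<^sub>3\<close>; in that case minimality of \<open>S\<close> gives \<open>x\<^sub>3\<close> a leaf and \<open>op3\<close> can be undone. So \<open>x\<^sub>2\<close>
  has degree 2, and minimality of the cover forces \<open>x\<^sub>3 \<notin> S\<close>. A further branch \<open>y\<^sub>2 y\<^sub>1 y\<^sub>0\<close> at \<open>x\<^sub>3\<close> would
  have the same shape, and exchanging \<open>x\<^sub>2, y\<^sub>2\<close> for \<open>x\<^sub>3\<close> would give a smaller cover. Hence \<open>x\<^sub>3\<close> has
  degree 2 and \<open>x\<^sub>0, \<dots>, x\<^sub>3\<close> can be deleted (\<open>op1\<close>).\<close>

section \<open>Adjacency and extremal sets\<close>

lemma adjacent_sym: "adjacent G x y \<longleftrightarrow> adjacent G y x"
  by (simp add: adjacent_def insert_commute)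

lemma adjacentD:
  assumes "simple_graph G" "adjacent G x y"
  shows "x \<in> verts G" "y \<in> verts G" "x \<noteq> y"
proof -
  have "{x, y} \<subseteq> verts G" "card {x, y} = 2"
    using assms unfolding simple_graph_def adjacent_def by blast+
  then show "x \<in> verts G" "y \<in> verts G" "x \<noteq> y" by auto
qed

lemma edge_adjacent:
  assumes "simple_graph G" "e \<in> edges G"
  obtains x y where "e = {x, y}" "adjacent G x y"
proof -
  have "card e = 2" using assms unfolding simple_graph_def by blast
  then obtain x y where "e = {x, y}" by (meson card_2_iff)
  with assms that show ?thesis unfolding adjacent_def by blast
qed

lemma neighbors_simple: "simple_graph G \<Longrightarrow> neighbors G x = {y. adjacent G x y}"
  using adjacentD unfolding neighbors_def by fastforce

lemma leaf_iff:
  assumes "simple_graph G"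
  shows "leaf G x \<longleftrightarrow> (\<exists>w. \<forall>y. adjacent G x y \<longleftrightarrow> y = w)"
proof
  assume "leaf G x"
  then obtain w where "{y. adjacent G x y} = {w}"
    unfolding leaf_def degree_def neighbors_simple[OF assms] using card_1_singletonE by auto
  then show "\<exists>w. \<forall>y. adjacent G x y \<longleftrightarrow> y = w" by blast
next
  assume "\<exists>w. \<forall>y. adjacent G x y \<longleftrightarrow> y = w"
  then obtain w where w: "\<forall>y. adjacent G x y \<longleftrightarrow> y = w" ..
  then have "{y. adjacent G x y} = {w}" by blast
  moreover have "x \<in> verts G" using w adjacentD[OF assms] by blast
  ultimately show "leaf G x"
    unfolding leaf_def degree_def neighbors_simple[OF assms] by simp
qed

lemma total_dominating_set_adjacent:
  assumes "simple_graph G"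
  shows "total_dominating_set G D \<longleftrightarrow>
    D \<subseteq> verts G \<and> (\<forall>x\<in>verts G. \<exists>y\<in>D. adjacent G x y)"
  unfolding total_dominating_set_iff neighbors_simple[OF assms] by blast

lemma vertex_cover_adjacent:
  assumes "simple_graph G"
  shows "vertex_cover G X \<longleftrightarrow> X \<subseteq> verts G \<and> (\<forall>x y. adjacent G x y \<longrightarrow> x \<in> X \<or> y \<in> X)"
proof -
  have "(\<forall>e\<in>edges G. e \<inter> X \<noteq> {}) \<longleftrightarrow> (\<forall>x y. adjacent G x y \<longrightarrow> x \<in> X \<or> y \<in> X)"
  proof
    assume l: "\<forall>e\<in>edges G. e \<inter> X \<noteq> {}"
    show "\<forall>x y. adjacent G x y \<longrightarrow> x \<in> X \<or> y \<in> X"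
    proof (intro allI impI)
      fix x y assume "adjacent G x y"
      then have "{x, y} \<in> edges G" unfolding adjacent_def .
      from bspec[OF l this]
      show "x \<in> X \<or> y \<in> X" by blast
    qed
  next
    assume r: "\<forall>x y. adjacent G x y \<longrightarrow> x \<in> X \<or> y \<in> X"
    show "\<forall>e\<in>edges G. e \<inter> X \<noteq> {}"
    proof
      fix e assume "e \<in> edges G"
      then obtain x y where "e = {x, y}" "adjacent G x y" using edge_adjacent[OF assms] by blast
      with r show "e \<inter> X \<noteq> {}" by auto
    qed
  qed
  then show ?thesis unfolding vertex_cover_def by blast
qed

text \<open>Replaces the numerical minima by comparison with every competitor; \<open>P X\<close> on
  both sides guarantees that the \<open>LEAST\<close> is attained.\<close>

lemma card_eq_Least_iff:
  "P X \<and> card X = (LEAST k. \<exists>X. P X \<and> card X = k) \<longleftrightarrow> P X \<and> (\<forall>Y. P Y \<longrightarrow> card X \<le> card Y)"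
proof (intro conj_cong refl iffI allI impI)
  fix Y assume "card X = (LEAST k. \<exists>X. P X \<and> card X = k)" "P Y"
  then show "card X \<le> card Y" by (metis (mono_tags, lifting) Least_le)
next
  assume "P X" "\<forall>Y. P Y \<longrightarrow> card X \<le> card Y"
  then show "card X = (LEAST k. \<exists>X. P X \<and> card X = k)"
    by (intro Least_equality[symmetric]) auto
qed

lemma gamma_t_set_iff:
  "gamma_t_set G S \<longleftrightarrow>
    total_dominating_set G S \<and> (\<forall>D. total_dominating_set G D \<longrightarrow> card S \<le> card D)"
  unfolding gamma_t_set_def total_domination_number_def by (rule card_eq_Least_iff)

lemma tau_set_iff:
  "tau_set G S \<longleftrightarrow> vertex_cover G S \<and> (\<forall>X. vertex_cover G X \<longrightarrow> card S \<le> card X)"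
  unfolding tau_set_def vertex_cover_number_def by (rule card_eq_Least_iff)

text \<open>If \<open>u\<close> is the only private neighbor of \<open>w\<close>, removing
  \<open>w\<close> leaves only \<open>u\<close> undominated. Conversely, adding a neighbor
  \<open>w\<close> of \<open>u\<close> to the smaller set \<open>D\<close> gives a minimum total
  dominating set again, and there \<open>w\<close> has \<open>u\<close> as its only private
  neighbor.\<close>

lemma quasi_isolated_iff:
  assumes G: "simple_graph G" and S: "gamma_t_set G S" and u: "u \<in> verts G"
  shows "quasi_isolated G u \<longleftrightarrow>
    (\<exists>D\<subseteq>verts G. (\<forall>x\<in>verts G - {u}. \<exists>y\<in>D. adjacent G x y) \<and> card D < card S)"
proof
  assume "quasi_isolated G u"
  then obtain D w where D: "gamma_t_set G D" and w: "w \<in> D" "private_neighbors G w D = {u}"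
    unfolding quasi_isolated_def quasi_isolated_wrt_def by blast
  have sub: "D \<subseteq> verts G" and dom: "\<forall>x\<in>verts G. \<exists>y\<in>D. adjacent G x y"
    using D unfolding gamma_t_set_iff total_dominating_set_adjacent[OF G] by blast+
  have "\<exists>y\<in>D - {w}. adjacent G x y" if x: "x \<in> verts G - {u}" for x
  proof -
    have "x \<notin> private_neighbors G w D" using w(2) x by simp
    then have "{y. adjacent G x y} \<inter> D \<noteq> {w}"
      using x unfolding private_neighbors_def neighbors_simple[OF G] by simp
    moreover obtain y where "y \<in> D" "adjacent G x y" using dom x by blast
    ultimately show ?thesis using w(1) by (cases "y = w") auto
  qed
  moreover have "finite D" using sub G finite_subset unfolding simple_graph_def by blast
  then have "card (D - {w}) < card D" using w by (meson card_Diff1_less)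
  then have "card (D - {w}) < card S" using D S unfolding gamma_t_set_def by simp
  ultimately show
    "\<exists>D\<subseteq>verts G. (\<forall>x\<in>verts G - {u}. \<exists>y\<in>D. adjacent G x y) \<and> card D < card S"
    using sub by (intro exI[of _ "D - {w}"]) blast
next
  assume "\<exists>D\<subseteq>verts G. (\<forall>x\<in>verts G - {u}. \<exists>y\<in>D. adjacent G x y) \<and> card D < card S"
  then obtain D where sub: "D \<subseteq> verts G" and dom: "\<forall>x\<in>verts G - {u}. \<exists>y\<in>D. adjacent G x y"
    and less: "card D < card S" by blast
  \<comment> \<open>\<open>D\<close> is too small to be a total dominating set, so the vertex it
    misses must be \<open>u\<close>.\<close>
  have nd: "\<not> total_dominating_set G D" using S less unfolding gamma_t_set_iff by fastforce
  then have un: "\<not> adjacent G u y" if "y \<in> D" for y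
    using sub dom that unfolding total_dominating_set_adjacent[OF G] by blast
  obtain w where w: "adjacent G u w" "w \<in> verts G"
    using S u adjacentD(2)[OF G] unfolding gamma_t_set_iff total_dominating_set_adjacent[OF G] by blast
  have t: "total_dominating_set G (insert w D)"
    unfolding total_dominating_set_adjacent[OF G] using sub dom w by blast
  moreover have "finite D" using sub G finite_subset unfolding simple_graph_def by blast
  then have "card (insert w D) \<le> card S" using less by (simp add: card_insert_if)
  ultimately have "gamma_t_set G (insert w D)" using S unfolding gamma_t_set_iff by fastforce
  moreover have "private_neighbors G w (insert w D) = {u}"
  proof -
    have "w \<notin> D" using un w by blast
    have "{y. adjacent G u y} \<inter> insert w D = {w}" using un w by auto
    moreover have "{y. adjacent G x y} \<inter> insert w D \<noteq> {w}" if x: "x \<in> verts G - {u}" for x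
    proof -
      obtain y where "y \<in> D" "adjacent G x y" using dom x by blast
      then show ?thesis using \<open>w \<notin> D\<close> by auto
    qed
    ultimately show ?thesis
      using u unfolding private_neighbors_def neighbors_simple[OF G] by auto
  qed
  ultimately show "quasi_isolated G u"
    unfolding quasi_isolated_def quasi_isolated_wrt_def by blast
qed

section \<open>Small paths\<close>

text \<open>Named vertices turn the list indices of \<open>is_path_graph\<close> into finite case
  distinctions.\<close>

definition path4 :: "'a \<Rightarrow> 'a \<Rightarrow> 'a \<Rightarrow> 'a \<Rightarrow> 'a ugraph" where
  "path4 a b c d = \<lparr>verts = {a, b, c, d}, edges = {{a, b}, {b, c}, {c, d}}\<rparr>"

definition path2 :: "'a \<Rightarrow> 'a \<Rightarrow> 'a ugraph" where
  "path2 a b = \<lparr>verts = {a, b}, edges = {{a, b}}\<rparr>"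

text \<open>Makes \<open>op2\<close> an instance of \<open>graph_sum\<close>.\<close>

definition path1 :: "'a \<Rightarrow> 'a ugraph" where
  "path1 a = \<lparr>verts = {a}, edges = {}\<rparr>"

lemma path4_rev: "path4 a b c d = path4 d c b a"
  unfolding path4_def by (auto simp: insert_commute)

lemma path2_rev: "path2 a b = path2 b a"
  unfolding path2_def by (simp add: insert_commute)

lemma verts_path [simp]:
  "verts (path4 a b c d) = {a, b, c, d}" "verts (path2 a b) = {a, b}" "verts (path1 a) = {a}"
  unfolding path4_def path2_def path1_def by simp_all

lemma adjacent_path4:
  "adjacent (path4 a b c d) x y \<longleftrightarrow> x = a \<and> y = b \<or> x = b \<and> y = a \<or> x = b \<and> y = c \<or>
    x = c \<and> y = b \<or> x = c \<and> y = d \<or> x = d \<and> y = c"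
  unfolding adjacent_def path4_def by (auto simp: doubleton_eq_iff)

lemma adjacent_path2: "adjacent (path2 a b) x y \<longleftrightarrow> x = a \<and> y = b \<or> x = b \<and> y = a"
  unfolding adjacent_def path2_def by (auto simp: doubleton_eq_iff)

lemma adjacent_path1: "\<not> adjacent (path1 a) x y"
  unfolding adjacent_def path1_def by simp

lemma simple_path4: "distinct [a, b, c, d] \<Longrightarrow> simple_graph (path4 a b c d)"
  unfolding simple_graph_def path4_def by auto

lemma simple_path2: "a \<noteq> b \<Longrightarrow> simple_graph (path2 a b)"
  unfolding simple_graph_def path2_def by auto

lemma simple_path1: "simple_graph (path1 a)"
  unfolding simple_graph_def path1_def by auto

lemma is_path_graph4_iff:
  "is_path_graph 4 P \<longleftrightarrow> (\<exists>a b c d. distinct [a, b, c, d] \<and> P = path4 a b c d)"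
proof -
  have eq: "\<lparr>verts = set [a, b, c, d],
      edges = {{[a, b, c, d] ! i, [a, b, c, d] ! Suc i} | i. Suc i < 4}\<rparr> = path4 a b c d"
    for a b c d :: 'a
  proof -
    have "{{[a, b, c, d] ! i, [a, b, c, d] ! Suc i} | i. Suc i < 4} =
        (\<lambda>i. {[a, b, c, d] ! i, [a, b, c, d] ! Suc i}) ` {0, 1, 2}"
    proof -
      have "{i. Suc i < 4} = {0, 1, 2}" by auto
      then show ?thesis by (metis setcompr_eq_image)
    qed
    then show ?thesis unfolding path4_def by simp
  qed
  show ?thesis
  proof
    assume "is_path_graph 4 P"
    then obtain xs where xs: "distinct xs" "length xs = 4"
      "P = \<lparr>verts = set xs, edges = {{xs ! i, xs ! Suc i} | i. Suc i < 4}\<rparr>"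
      unfolding is_path_graph_def by blast
    from xs(2) obtain a b c d where l: "xs = [a, b, c, d]"
      by (auto simp: numeral_eq_Suc length_Suc_conv)
    show "\<exists>a b c d. distinct [a, b, c, d] \<and> P = path4 a b c d"
      using xs(1,3) unfolding l eq by (intro exI conjI)
  next
    assume "\<exists>a b c d. distinct [a, b, c, d] \<and> P = path4 a b c d"
    then obtain a b c d where d: "distinct [a, b, c, d]" and P: "P = path4 a b c d"
      by (elim exE conjE)
    show "is_path_graph 4 P" unfolding is_path_graph_def P eq[symmetric]
      by (rule exI[of _ "[a, b, c, d]"], intro conjI refl d) simp
  qed
qed

lemma is_path_graph2_iff: "is_path_graph 2 P \<longleftrightarrow> (\<exists>a b. a \<noteq> b \<and> P = path2 a b)"
proof -
  have eq: "\<lparr>verts = set [a, b], edges = {{[a, b] ! i, [a, b] ! Suc i} | i. Suc i < 2}\<rparr> =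
      path2 a b" for a b :: 'a
    unfolding path2_def by auto
  show ?thesis
  proof
    assume "is_path_graph 2 P"
    then obtain xs where xs: "distinct xs" "length xs = 2"
      "P = \<lparr>verts = set xs, edges = {{xs ! i, xs ! Suc i} | i. Suc i < 2}\<rparr>"
      unfolding is_path_graph_def by blast
    from xs(2) obtain a b where l: "xs = [a, b]"
      by (auto simp: numeral_eq_Suc length_Suc_conv)
    show "\<exists>a b. a \<noteq> b \<and> P = path2 a b"
      using xs(1,3) unfolding l eq by (intro exI conjI) auto
  next
    assume "\<exists>a b. a \<noteq> b \<and> P = path2 a b"
    then obtain a b where d: "a \<noteq> b" and P: "P = path2 a b" by (elim exE conjE)
    show "is_path_graph 2 P" unfolding is_path_graph_def P eq[symmetric]
      by (rule exI[of _ "[a, b]"], intro conjI refl) (use d in simp_all)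
  qed
qed

lemma leaf_path4:
  assumes "distinct [a, b, c, d]"
  shows "leaf (path4 a b c d) x \<longleftrightarrow> x = a \<or> x = d"
proof
  assume "leaf (path4 a b c d) x"
  then obtain w where w: "adjacent (path4 a b c d) x y \<longleftrightarrow> y = w" for y
    unfolding leaf_iff[OF simple_path4[OF assms]] by blast
  \<comment> \<open>An inner vertex has two distinct neighbors, which cannot both be
    \<open>w\<close>; a vertex off the path has none, against the instance at \<open>w\<close>
    itself.\<close>
  show "x = a \<or> x = d"
    using w[of a] w[of b] w[of c] w[of d] w[of w] assms unfolding adjacent_path4 by auto
next
  have "adjacent (path4 a b c d) a y \<longleftrightarrow> y = b" "adjacent (path4 a b c d) d y \<longleftrightarrow> y = c" for y
    using assms unfolding adjacent_path4 by auto
  moreover assume "x = a \<or> x = d"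
  ultimately show "leaf (path4 a b c d) x"
    unfolding leaf_iff[OF simple_path4[OF assms]] by metis
qed

lemma support_path4:
  assumes "distinct [a, b, c, d]"
  shows "support_vertex (path4 a b c d) x \<longleftrightarrow> x = b \<or> x = c"
  unfolding support_vertex_def leaf_path4[OF assms] neighbors_simple[OF simple_path4[OF assms]]
    adjacent_path4 using assms by auto

text \<open>The two leaves force \<open>b\<close> and \<open>c\<close> into every total dominating
  set, and the disjoint edges \<open>ab\<close> and \<open>cd\<close> force two vertices into every
  cover.\<close>

lemma gamma_t_tau_path4:
  assumes d: "distinct [a, b, c, d]"
  shows "gamma_t_tau_set (path4 a b c d) {b, c}"
proof -
  note s = simple_path4[OF d]
  have "2 \<le> card D" if "total_dominating_set (path4 a b c d) D" for D
  proof -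
    have "{b, c} \<subseteq> D" "finite D"
      using that d finite_subset[of D "{a, b, c, d}"]
      unfolding total_dominating_set_adjacent[OF s] adjacent_path4 by auto
    then have "card {b, c} \<le> card D" by (meson card_mono)
    then show ?thesis using d by simp
  qed
  moreover have "2 \<le> card X" if "vertex_cover (path4 a b c d) X" for X
  proof -
    have "finite X" "a \<in> X \<or> b \<in> X" "c \<in> X \<or> d \<in> X"
      using that finite_subset[of X "{a, b, c, d}"]
      unfolding vertex_cover_adjacent[OF s] adjacent_path4 by auto
    then obtain x y where "{x, y} \<subseteq> X" "x \<noteq> y" using d by auto
    then show ?thesis using card_mono[OF \<open>finite X\<close>, of "{x, y}"] by simp
  qed
  moreover have "total_dominating_set (path4 a b c d) {b, c}"
    unfolding total_dominating_set_adjacent[OF s] adjacent_path4 by simp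
  moreover have "vertex_cover (path4 a b c d) {b, c}"
    unfolding vertex_cover_adjacent[OF s] adjacent_path4 by auto
  moreover have "card {b, c} = 2" using d by simp
  ultimately show ?thesis unfolding gamma_t_tau_set_def gamma_t_set_iff tau_set_iff by simp
qed

section \<open>Joining two graphs by an edge\<close>

text \<open>Common setting of the operations and their inverses: \<open>G\<close> is the smaller
  tree, \<open>H\<close> the attached path, and \<open>uv\<close> the only edge between
  them.\<close>

locale edge_sum =
  fixes G H :: "'a ugraph" and u v :: 'a
  assumes simple: "simple_graph G" "simple_graph H"
    and disjoint: "verts G \<inter> verts H = {}"
    and ends: "u \<in> verts G" "v \<in> verts H"
begin

abbreviation GH :: "'a ugraph" where "GH \<equiv> graph_sum G H u v"

lemma verts_sum [simp]: "verts GH = verts G \<union> verts H"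
  unfolding graph_sum_def by simp

lemma adjacent_sum:
  "adjacent GH x y \<longleftrightarrow>
    adjacent G x y \<or> adjacent H x y \<or> x = u \<and> y = v \<or> x = v \<and> y = u"
  unfolding graph_sum_def adjacent_def by (auto simp: doubleton_eq_iff)

lemma simple_sum: "simple_graph GH"
proof -
  have "u \<noteq> v" using ends disjoint by blast
  then show ?thesis using simple ends unfolding simple_graph_def graph_sum_def by auto
qed

lemma finite_sum: "finite (verts G)" "finite (verts H)"
  using simple unfolding simple_graph_def by auto

lemma card_split:
  assumes "D \<subseteq> verts GH"
  shows "card D = card (D \<inter> verts G) + card (D \<inter> verts H)"
proof -
  have "D = (D \<inter> verts G) \<union> (D \<inter> verts H)" using assms by auto
  moreover have "card ((D \<inter> verts G) \<union> (D \<inter> verts H)) = card (D \<inter> verts G) + card (D \<inter> verts H)"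
    using disjoint finite_sum by (intro card_Un_disjoint) auto
  ultimately show ?thesis by simp
qed

lemma adjacent_sum_G:
  "x \<in> verts G \<Longrightarrow> adjacent GH x y \<longleftrightarrow> adjacent G x y \<or> x = u \<and> y = v"
  using adjacent_sum adjacentD[OF simple(2)] disjoint ends by blast

lemma adjacent_sum_H:
  "x \<in> verts H \<Longrightarrow> adjacent GH x y \<longleftrightarrow> adjacent H x y \<or> x = v \<and> y = u"
  using adjacent_sum adjacentD[OF simple(1)] disjoint ends by blast

text \<open>The joining edge can help to dominate only its own ends, so the condition splits into
  one for each side, with an exception at \<open>u\<close> and one at \<open>v\<close>.\<close>

lemma total_dominating_sum:
  "total_dominating_set GH D \<longleftrightarrow> D \<subseteq> verts G \<union> verts H \<and>
    (\<forall>x\<in>verts G. (\<exists>y\<in>D \<inter> verts G. adjacent G x y) \<or> x = u \<and> v \<in> D) \<and>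
    (\<forall>x\<in>verts H. (\<exists>y\<in>D \<inter> verts H. adjacent H x y) \<or> x = v \<and> u \<in> D)"
proof -
  have "(\<exists>y\<in>D. adjacent GH x y) \<longleftrightarrow> (\<exists>y\<in>D \<inter> verts G. adjacent G x y) \<or> x = u \<and> v \<in> D"
    if "x \<in> verts G" for x
    using adjacent_sum_G[OF that] adjacentD(2)[OF simple(1), of x] by auto
  moreover have
    "(\<exists>y\<in>D. adjacent GH x y) \<longleftrightarrow> (\<exists>y\<in>D \<inter> verts H. adjacent H x y) \<or> x = v \<and> u \<in> D"
    if "x \<in> verts H" for x
    using adjacent_sum_H[OF that] adjacentD(2)[OF simple(2), of x] by auto
  ultimately show ?thesis
    unfolding total_dominating_set_adjacent[OF simple_sum] verts_sum ball_Un by (simp cong: ball_cong)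
qed

lemma vertex_cover_sum:
  "vertex_cover GH X \<longleftrightarrow> X \<subseteq> verts G \<union> verts H \<and> vertex_cover G (X \<inter> verts G) \<and>
    vertex_cover H (X \<inter> verts H) \<and> (u \<in> X \<or> v \<in> X)"
proof -
  have "(\<forall>x y. adjacent GH x y \<longrightarrow> x \<in> X \<or> y \<in> X) \<longleftrightarrow>
      (\<forall>x y. adjacent G x y \<longrightarrow> x \<in> X \<or> y \<in> X) \<and>
      (\<forall>x y. adjacent H x y \<longrightarrow> x \<in> X \<or> y \<in> X) \<and> (u \<in> X \<or> v \<in> X)"
    unfolding adjacent_sum by (auto simp: imp_disjL all_conj_distrib)
  moreover have "adjacent G x y \<Longrightarrow> x \<in> X \<inter> verts G \<or> y \<in> X \<inter> verts G \<longleftrightarrow> x \<in> X \<or> y \<in> X" for x y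
    using adjacentD[OF simple(1)] by blast
  moreover have "adjacent H x y \<Longrightarrow> x \<in> X \<inter> verts H \<or> y \<in> X \<inter> verts H \<longleftrightarrow> x \<in> X \<or> y \<in> X" for x y
    using adjacentD[OF simple(2)] by blast
  ultimately show ?thesis
    unfolding vertex_cover_adjacent[OF simple_sum] vertex_cover_adjacent[OF simple(1)]
      vertex_cover_adjacent[OF simple(2)] verts_sum by (simp cong: imp_cong)
qed

lemma Un_parts:
  assumes "S \<subseteq> verts G" "A \<subseteq> verts H"
  shows "(S \<union> A) \<inter> verts G = S" "(S \<union> A) \<inter> verts H = A" "card (S \<union> A) = card S + card A"
proof -
  show 1: "(S \<union> A) \<inter> verts G = S" "(S \<union> A) \<inter> verts H = A" using assms disjoint by auto
  have "S \<union> A \<subseteq> verts GH" using assms by auto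
  from card_split[OF this] show "card (S \<union> A) = card S + card A" unfolding 1 .
qed

lemma total_dominating_UnI:
  assumes "total_dominating_set G D" "A \<subseteq> verts H"
    and "\<And>x. x \<in> verts H \<Longrightarrow> (\<exists>y\<in>A. adjacent H x y) \<or> x = v \<and> u \<in> D"
  shows "total_dominating_set GH (D \<union> A)"
proof -
  have D: "D \<subseteq> verts G" "\<forall>x\<in>verts G. \<exists>y\<in>D. adjacent G x y"
    using assms(1) unfolding total_dominating_set_adjacent[OF simple(1)] by simp_all
  show ?thesis
    unfolding total_dominating_sum Un_parts[OF D(1) assms(2)] using D assms(2,3) by auto
qed

lemma vertex_cover_UnI:
  assumes "vertex_cover G X" "vertex_cover H A" "u \<in> X \<or> v \<in> A"
  shows "vertex_cover GH (X \<union> A)"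
proof -
  have "X \<subseteq> verts G" "A \<subseteq> verts H" using assms unfolding vertex_cover_def by auto
  then show ?thesis
    unfolding vertex_cover_sum Un_parts[OF \<open>X \<subseteq> verts G\<close> \<open>A \<subseteq> verts H\<close>] using assms by auto
qed

text \<open>A cover of the sum restricts to covers of both sides, so minimality as a cover follows
  by adding. A total dominating set need not restrict, because of the joining edge; its lower bound
  \<open>tds\<close> is therefore left to each operation.\<close>

lemma gamma_t_tau_sumI:
  assumes S: "gamma_t_tau_set G S" and A: "vertex_cover H A" "u \<in> S \<or> v \<in> A"
    and dom: "\<And>x. x \<in> verts H \<Longrightarrow> (\<exists>y\<in>A. adjacent H x y) \<or> x = v \<and> u \<in> S"
    and tds: "\<And>D. total_dominating_set GH D \<Longrightarrow> card S + card A \<le> card D"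
    and vc: "\<And>X. vertex_cover H X \<Longrightarrow> card A \<le> card X"
  shows "gamma_t_tau_set GH (S \<union> A)"
proof -
  have AH: "A \<subseteq> verts H" using A unfolding vertex_cover_def by simp
  have S': "total_dominating_set G S" "vertex_cover G S" "S \<subseteq> verts G"
    "\<And>X. vertex_cover G X \<Longrightarrow> card S \<le> card X"
    using S unfolding gamma_t_tau_set_def gamma_t_set_iff tau_set_iff vertex_cover_def by auto
  have "card S + card A \<le> card X" if X: "vertex_cover GH X" for X
  proof -
    have "card S \<le> card (X \<inter> verts G)" "card A \<le> card (X \<inter> verts H)"
      using S'(4) vc X unfolding vertex_cover_sum by blast+
    moreover have "X \<subseteq> verts GH" using X unfolding vertex_cover_sum by simp
    ultimately show ?thesis using card_split[of X] by linarith
  qed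
  then show ?thesis
    using total_dominating_UnI[OF S'(1) AH dom] vertex_cover_UnI[OF S'(2) A] tds
    unfolding gamma_t_tau_set_def gamma_t_set_iff tau_set_iff Un_parts(3)[OF S'(3) AH]
    by blast
qed

text \<open>A better set for \<open>G\<close> would extend, at the price that \<open>S\<close> pays
  on \<open>H\<close>, to a set for the sum better than \<open>S\<close>. The assumption
  \<open>t\<close> excludes that \<open>u\<close> is dominated only from \<open>v\<close>.\<close>

lemma gamma_t_tau_sumD:
  assumes S: "gamma_t_tau_set GH S" and t: "total_dominating_set G (S \<inter> verts G)"
    and tds: "\<And>D. total_dominating_set G D \<Longrightarrow>
      \<exists>D'. total_dominating_set GH D' \<and> card D' \<le> card D + card (S \<inter> verts H)"
    and vc: "\<And>X. vertex_cover G X \<Longrightarrow>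
      \<exists>X'. vertex_cover GH X' \<and> card X' \<le> card X + card (S \<inter> verts H)"
  shows "gamma_t_tau_set G (S \<inter> verts G)"
proof -
  have S': "vertex_cover GH S" "\<And>X. vertex_cover GH X \<Longrightarrow> card S \<le> card X"
    "\<And>D. total_dominating_set GH D \<Longrightarrow> card S \<le> card D"
    using S unfolding gamma_t_tau_set_def gamma_t_set_iff tau_set_iff by auto
  have c: "card S = card (S \<inter> verts G) + card (S \<inter> verts H)"
    using S'(1) card_split unfolding vertex_cover_def by blast
  have "card (S \<inter> verts G) \<le> card D" if "total_dominating_set G D" for D
    using tds[OF that] S'(3) c by fastforce
  moreover have "card (S \<inter> verts G) \<le> card X" if "vertex_cover G X" for X
    using vc[OF that] S'(2) c by fastforce
  moreover have "vertex_cover G (S \<inter> verts G)" using S'(1) unfolding vertex_cover_sum by blast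
  ultimately show ?thesis
    using t unfolding gamma_t_tau_set_def gamma_t_set_iff tau_set_iff by blast
qed

text \<open>The part of \<open>D\<close> in \<open>G\<close> can miss only \<open>u\<close>, and
  only when \<open>v\<close> is in \<open>D\<close>. One neighbor of \<open>u\<close> repairs this;
  if \<open>u\<close> is not quasi-isolated, missing it saves nothing.\<close>

lemma card_total_dominating_sum:
  assumes S: "gamma_t_set G S" and D: "total_dominating_set GH D"
  shows "v \<notin> D \<Longrightarrow> card S \<le> card (D \<inter> verts G)"
    and "card S \<le> Suc (card (D \<inter> verts G))"
    and "\<not> quasi_isolated G u \<Longrightarrow> card S \<le> card (D \<inter> verts G)"
proof -
  have D': "\<forall>x\<in>verts G. (\<exists>y\<in>D \<inter> verts G. adjacent G x y) \<or> x = u \<and> v \<in> D"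
    using D unfolding total_dominating_sum by blast
  have S': "\<And>D. total_dominating_set G D \<Longrightarrow> card S \<le> card D" "total_dominating_set G S"
    using S unfolding gamma_t_set_iff by auto
  show "card S \<le> card (D \<inter> verts G)" if "v \<notin> D"
    using D' that S'(1) unfolding total_dominating_set_adjacent[OF simple(1)] by blast
  obtain t where t: "adjacent G u t" "t \<in> verts G"
    using S'(2) ends(1) adjacentD(2)[OF simple(1)]
    unfolding total_dominating_set_adjacent[OF simple(1)] by blast
  have "total_dominating_set G (insert t (D \<inter> verts G))"
    using D' t unfolding total_dominating_set_adjacent[OF simple(1)] by blast
  from S'(1)[OF this] show "card S \<le> Suc (card (D \<inter> verts G))"
    using finite_sum(1) by (simp add: card_insert_if split: if_splits)
  show "card S \<le> card (D \<inter> verts G)" if q: "\<not> quasi_isolated G u"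
  proof (rule ccontr)
    assume "\<not> card S \<le> card (D \<inter> verts G)"
    then have "\<exists>D\<subseteq>verts G. (\<forall>x\<in>verts G - {u}. \<exists>y\<in>D. adjacent G x y) \<and> card D < card S"
      using D' by (intro exI[of _ "D \<inter> verts G"]) auto
    with q quasi_isolated_iff[OF simple(1) S ends(1)] show False by blast
  qed
qed

end

section \<open>The operations preserve the existence of a common minimum set\<close>

lemma card_vertex_cover_path4:
  assumes "distinct [a, b, c, d]" "vertex_cover (path4 a b c d) X"
  shows "2 \<le> card X"
  using gamma_t_tau_path4[OF assms(1)] assms unfolding gamma_t_tau_set_def tau_set_iff by fastforce

text \<open>Dominating \<open>d\<close> and \<open>c\<close> takes \<open>c\<close> and one of
  \<open>b\<close>, \<open>d\<close>. If \<open>D\<close> also contains \<open>a\<close>, this third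
  path vertex pays for the one that may be saved in \<open>G\<close>; otherwise nothing can be saved
  there.\<close>

lemma gamma_t_tau_op1:
  assumes E: "edge_sum G (path4 a b c d) u a" and d: "distinct [a, b, c, d]"
    and S: "gamma_t_tau_set G S" "u \<in> S"
  shows "gamma_t_tau_set (graph_sum G (path4 a b c d) u a) (S \<union> {b, c})"
proof -
  interpret edge_sum G "path4 a b c d" u a by (rule E)
  have g: "gamma_t_set G S" using S unfolding gamma_t_tau_set_def by simp
  show ?thesis
  proof (rule gamma_t_tau_sumI[OF S(1)])
    fix D assume D: "total_dominating_set GH D"
    then have "D \<subseteq> verts GH" unfolding total_dominating_set_iff by simp
    note cs = card_split[OF this]
    have H: "\<forall>x\<in>{a, b, c, d}. (\<exists>y\<in>D \<inter> {a, b, c, d}. adjacent (path4 a b c d) x y) \<or> x = a \<and> u \<in> D"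
      using D unfolding total_dominating_sum by simp
    have "c \<in> D" "b \<in> D \<or> d \<in> D" using d bspec[OF H, of d] bspec[OF H, of c]
      unfolding adjacent_path4 by auto
    then obtain z where z: "{z, c} \<subseteq> D \<inter> {a, b, c, d}" "z \<noteq> c" "z \<noteq> a" using d by auto
    show "card S + card {b, c} \<le> card D"
    proof (cases "a \<in> D")
      case True
      then have "{a, z, c} \<subseteq> D \<inter> {a, b, c, d}" using z by auto
      then have "card {a, z, c} \<le> card (D \<inter> {a, b, c, d})" by (intro card_mono) auto
      then show ?thesis using card_total_dominating_sum(2)[OF g D] cs d z by simp
    next
      case False
      have "card {z, c} \<le> card (D \<inter> {a, b, c, d})" using z by (intro card_mono) auto
      then show ?thesis using card_total_dominating_sum(1)[OF g D False] cs d z by simp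
    qed
  next
    show "vertex_cover (path4 a b c d) {b, c}"
      using gamma_t_tau_path4[OF d] unfolding gamma_t_tau_set_def tau_set_iff by simp
    show "card {b, c} \<le> card X" if "vertex_cover (path4 a b c d) X" for X
      using card_vertex_cover_path4[OF d that] d by simp
  qed (use S in \<open>auto simp: adjacent_path4\<close>)
qed

text \<open>As \<open>u\<close> is in \<open>S\<close>, it covers the new edge and dominates
  \<open>v\<close>. A competitor profits from \<open>v\<close> only by containing it, which costs as
  much as it can save in \<open>G\<close>.\<close>

lemma gamma_t_tau_op2:
  assumes E: "edge_sum G (path1 v) u v" and S: "gamma_t_tau_set G S" "u \<in> S"
  shows "gamma_t_tau_set (graph_sum G (path1 v) u v) S"
proof -
  interpret edge_sum G "path1 v" u v by (rule E)
  have g: "gamma_t_set G S" using S unfolding gamma_t_tau_set_def by simp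
  have "gamma_t_tau_set GH (S \<union> {})"
  proof (rule gamma_t_tau_sumI[OF S(1)])
    fix D assume D: "total_dominating_set GH D"
    then have "D \<subseteq> verts GH" unfolding total_dominating_set_iff by simp
    note cs = card_split[OF this]
    show "card S + card {} \<le> card D"
    proof (cases "v \<in> D")
      case True
      then show ?thesis using card_total_dominating_sum(2)[OF g D] cs by simp
    next
      case False
      then show ?thesis using card_total_dominating_sum(1)[OF g D] cs by simp
    qed
  qed (use S in \<open>auto simp: vertex_cover_adjacent[OF simple_path1] adjacent_path1\<close>)
  then show ?thesis by simp
qed

text \<open>The leaf \<open>b\<close> forces \<open>a\<close> into every competitor, so
  \<open>u\<close> gets dominated from outside \<open>G\<close>; as \<open>u\<close> is not
  quasi-isolated, this saves nothing inside \<open>G\<close>.\<close>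

lemma gamma_t_tau_op3:
  assumes E: "edge_sum G (path2 a b) u a" and d: "a \<noteq> b"
    and S: "gamma_t_tau_set G S" "u \<in> S" and q: "\<not> quasi_isolated G u"
  shows "gamma_t_tau_set (graph_sum G (path2 a b) u a) (S \<union> {a})"
proof -
  interpret edge_sum G "path2 a b" u a by (rule E)
  have g: "gamma_t_set G S" using S unfolding gamma_t_tau_set_def by simp
  show ?thesis
  proof (rule gamma_t_tau_sumI[OF S(1)])
    fix D assume D: "total_dominating_set GH D"
    then have "D \<subseteq> verts GH" unfolding total_dominating_set_iff by simp
    note cs = card_split[OF this]
    have H: "\<forall>x\<in>{a, b}. (\<exists>y\<in>D \<inter> {a, b}. adjacent (path2 a b) x y) \<or> x = a \<and> u \<in> D"
      using D unfolding total_dominating_sum by simp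
    have "{a} \<subseteq> D \<inter> {a, b}" using d bspec[OF H, of b] unfolding adjacent_path2 by auto
    then have "card {a} \<le> card (D \<inter> {a, b})" by (intro card_mono) auto
    then show "card S + card {a} \<le> card D"
      using card_total_dominating_sum(3)[OF g D q] cs by simp
  next
    fix X assume X: "vertex_cover (path2 a b) X"
    then have "X \<noteq> {}" "finite X" using finite_subset[of X "{a, b}"]
      unfolding vertex_cover_adjacent[OF simple_path2[OF d]] adjacent_path2 by auto
    then show "card {a} \<le> card X" by (simp add: Suc_le_eq card_gt_0_iff)
  qed (use S in \<open>auto simp: vertex_cover_adjacent[OF simple_path2[OF d]] adjacent_path2\<close>)
qed

text \<open>The leaves \<open>a\<close> and \<open>d\<close> force \<open>b\<close> and
  \<open>c\<close> into every competitor, and \<open>b\<close> dominates \<open>u\<close> from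
  outside, which again saves nothing. Here \<open>b\<close> covers the joining edge, so
  \<open>u\<close> may lie outside \<open>S\<close>.\<close>

lemma gamma_t_tau_op4:
  assumes E: "edge_sum G (path4 a b c d) u b" and d: "distinct [a, b, c, d]"
    and S: "gamma_t_tau_set G S" and q: "\<not> quasi_isolated G u"
  shows "gamma_t_tau_set (graph_sum G (path4 a b c d) u b) (S \<union> {b, c})"
proof -
  interpret edge_sum G "path4 a b c d" u b by (rule E)
  have g: "gamma_t_set G S" using S unfolding gamma_t_tau_set_def by simp
  show ?thesis
  proof (rule gamma_t_tau_sumI[OF S(1)])
    fix D assume D: "total_dominating_set GH D"
    then have "D \<subseteq> verts GH" unfolding total_dominating_set_iff by simp
    note cs = card_split[OF this]
    have H: "\<forall>x\<in>{a, b, c, d}. (\<exists>y\<in>D \<inter> {a, b, c, d}. adjacent (path4 a b c d) x y) \<or> x = b \<and> u \<in> D"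
      using D unfolding total_dominating_sum by simp
    have "{b, c} \<subseteq> D \<inter> {a, b, c, d}" using d bspec[OF H, of d] bspec[OF H, of a]
      unfolding adjacent_path4 by auto
    then have "card {b, c} \<le> card (D \<inter> {a, b, c, d})" by (intro card_mono) auto
    then show "card S + card {b, c} \<le> card D"
      using card_total_dominating_sum(3)[OF g D q] cs by simp
  next
    show "vertex_cover (path4 a b c d) {b, c}"
      using gamma_t_tau_path4[OF d] unfolding gamma_t_tau_set_def tau_set_iff by simp
    show "card {b, c} \<le> card X" if "vertex_cover (path4 a b c d) X" for X
      using card_vertex_cover_path4[OF d that] d by simp
  qed (use S in \<open>auto simp: adjacent_path4\<close>)
qed

section \<open>Matching the operations with paths on named vertices\<close>

lemma ugraph_eqI:
  assumes "simple_graph G" "simple_graph H" "verts G = verts H"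
    and adj: "\<And>x y. adjacent G x y \<longleftrightarrow> adjacent H x y"
  shows "G = H"
proof -
  have "edges G = edges H"
  proof (intro equalityI subsetI)
    fix e assume e: "e \<in> edges G"
    then obtain x y where "e = {x, y}" "adjacent G x y" using edge_adjacent[OF assms(1)] by blast
    then show "e \<in> edges H" using adj unfolding adjacent_def by simp
  next
    fix e assume e: "e \<in> edges H"
    then obtain x y where "e = {x, y}" "adjacent H x y" using edge_adjacent[OF assms(2)] by blast
    then show "e \<in> edges G" using adj unfolding adjacent_def by simp
  qed
  then show ?thesis using assms(3) by simp
qed

lemma edge_sumI:
  assumes "simple_graph G" "simple_graph H" "verts G \<inter> verts H = {}" "u \<in> verts G" "v \<in> verts H"
  shows "edge_sum G H u v"
  using assms by unfold_locales

lemma op2_graph_sum: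
  "\<lparr>verts = insert v (verts T), edges = insert {u, v} (edges T)\<rparr> = graph_sum T (path1 v) u v"
  unfolding graph_sum_def path1_def by simp

text \<open>Reversing the path if necessary puts the attached vertex in the position that the lemmas
  on named paths expect.\<close>

lemma leaf_path_graph4E:
  assumes "is_path_graph 4 P" "leaf P v"
  obtains b c d where "distinct [v, b, c, d]" "P = path4 v b c d"
proof -
  from assms(1) obtain p q r s where p: "distinct [p, q, r, s]" "P = path4 p q r s"
    unfolding is_path_graph4_iff by (elim exE conjE)
  have "v = p \<or> v = s" using assms(2) unfolding p(2) leaf_path4[OF p(1)] .
  then show ?thesis
  proof
    assume v: "v = p"
    show ?thesis by (rule that[of q r s]) (use p v in simp_all)
  next
    assume v: "v = s"
    show ?thesis by (rule that[OF _ trans[OF p(2) path4_rev, folded v]]) (use p v in auto)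
  qed
qed

lemma support_path_graph4E:
  assumes "is_path_graph 4 P" "support_vertex P v"
  obtains a c d where "distinct [a, v, c, d]" "P = path4 a v c d"
proof -
  from assms(1) obtain p q r s where p: "distinct [p, q, r, s]" "P = path4 p q r s"
    unfolding is_path_graph4_iff by (elim exE conjE)
  have "v = q \<or> v = r" using assms(2) unfolding p(2) support_path4[OF p(1)] .
  then show ?thesis
  proof
    assume v: "v = q"
    show ?thesis by (rule that[of p r s]) (use p v in simp_all)
  next
    assume v: "v = r"
    show ?thesis by (rule that[OF _ trans[OF p(2) path4_rev, folded v]]) (use p v in auto)
  qed
qed

lemma path_graph2E:
  assumes "is_path_graph 2 P" "v \<in> verts P"
  obtains b where "v \<noteq> b" "P = path2 v b"
proof -
  from assms(1) obtain p q where p: "p \<noteq> q" "P = path2 p q"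
    unfolding is_path_graph2_iff by (elim exE conjE)
  have "v = p \<or> v = q" using assms(2) unfolding p(2) by simp
  then show ?thesis
  proof
    assume v: "v = p"
    show ?thesis by (rule that[of q]) (use p v in simp_all)
  next
    assume v: "v = q"
    show ?thesis by (rule that[OF _ trans[OF p(2) path2_rev, folded v]]) (use p v in auto)
  qed
qed

lemma gamma_t_tau_op:
  assumes T: "simple_graph T" and S: "gamma_t_tau_set T S"
    and "op1 T T' \<or> op2 T T' \<or> op3 T T' \<or> op4 T T'"
  shows "\<exists>S'. gamma_t_tau_set T' S'"
proof -
  consider "op1 T T'" | "op2 T T'" | "op3 T T'" | "op4 T T'" using assms(3) by blast
  then show ?thesis
  proof cases
    case 1
    then obtain u S P v where u: "u \<in> verts T" "gamma_t_tau_set T S" "u \<in> S" and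
      P: "is_path_graph 4 P" "verts T \<inter> verts P = {}" "leaf P v" and T': "T' = graph_sum T P u v"
      unfolding op1_def by blast
    obtain b c d where a: "distinct [v, b, c, d]" "P = path4 v b c d"
      using P(1,3) by (rule leaf_path_graph4E)
    have "simple_graph P" unfolding a(2) by (rule simple_path4[OF a(1)])
    then have E: "edge_sum T P u v" using T u P(2) a(2) by (intro edge_sumI) auto
    show ?thesis unfolding T' a(2)
      by (rule exI, rule gamma_t_tau_op1[OF E[unfolded a(2)] a(1) u(2,3)])
  next
    case 2
    then obtain u S v where u: "u \<in> verts T" "gamma_t_tau_set T S" "u \<in> S" and
      v: "v \<notin> verts T" and T': "T' = graph_sum T (path1 v) u v"
      unfolding op2_def op2_graph_sum by blast
    then have E: "edge_sum T (path1 v) u v" using T simple_path1 by (intro edge_sumI) auto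
    show ?thesis unfolding T' by (rule exI, rule gamma_t_tau_op2[OF E u(2,3)])
  next
    case 3
    then obtain u S P v where u: "u \<in> verts T" "gamma_t_tau_set T S" "u \<in> S"
      "\<not> quasi_isolated T u" and P: "is_path_graph 2 P" "verts T \<inter> verts P = {}" "v \<in> verts P"
      and T': "T' = graph_sum T P u v"
      unfolding op3_def by blast
    obtain b where a: "v \<noteq> b" "P = path2 v b" using P(1,3) by (rule path_graph2E)
    have "simple_graph P" unfolding a(2) by (rule simple_path2[OF a(1)])
    then have E: "edge_sum T P u v" using T u P(2) a(2) by (intro edge_sumI) auto
    show ?thesis unfolding T' a(2)
      by (rule exI, rule gamma_t_tau_op3[OF E[unfolded a(2)] a(1) u(2,3,4)])
  next
    case 4
    then obtain u P v where u: "u \<in> verts T" "\<not> quasi_isolated T u" and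
      P: "is_path_graph 4 P" "verts T \<inter> verts P = {}" "support_vertex P v"
      and T': "T' = graph_sum T P u v"
      unfolding op4_def by blast
    obtain a c d where a: "distinct [a, v, c, d]" "P = path4 a v c d"
      using P(1,3) by (rule support_path_graph4E)
    have "simple_graph P" unfolding a(2) by (rule simple_path4[OF a(1)])
    then have E: "edge_sum T P u v" using T u P(2) a(2) by (intro edge_sumI) auto
    \<comment> \<open>\<open>op4\<close> does not come with a common minimum set, so the given
      \<open>S\<close> is extended.\<close>
    show ?thesis unfolding T' a(2)
      by (rule exI, rule gamma_t_tau_op4[OF E[unfolded a(2)] a(1) S u(2)])
  qed
qed

lemma tree_family_gamma_t_tau:
  assumes "T \<in> tree_family"
  shows "\<exists>S. gamma_t_tau_set T S"
proof -
  obtain Ts where Ts: "Ts \<noteq> []" "\<forall>T\<in>set Ts. tree T" "is_path_graph 4 (hd Ts)" "last Ts = T"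
    and ops: "\<forall>i. Suc i < length Ts \<longrightarrow>
      op1 (Ts ! i) (Ts ! Suc i) \<or> op2 (Ts ! i) (Ts ! Suc i) \<or>
      op3 (Ts ! i) (Ts ! Suc i) \<or> op4 (Ts ! i) (Ts ! Suc i)"
    using assms unfolding tree_family_def by blast
  have "\<exists>S. gamma_t_tau_set (Ts ! i) S" if "i < length Ts" for i
    using that
  proof (induction i)
    case 0
    from Ts(3) obtain a b c d where "distinct [a, b, c, d]" "hd Ts = path4 a b c d"
      unfolding is_path_graph4_iff by blast
    then show ?case using gamma_t_tau_path4 Ts(1) by (metis hd_conv_nth)
  next
    case (Suc i)
    then have "simple_graph (Ts ! i)" using Ts(2) unfolding tree_def by simp
    then show ?case using Suc ops gamma_t_tau_op[of "Ts ! i"] by (meson Suc_lessD)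
  qed
  from this[of "length Ts - 1"] show ?thesis using Ts(1,4) by (simp add: last_conv_nth)
qed

section \<open>Undoing the operations\<close>

lemma adjacent_induced:
  "adjacent (induced_subgraph T S) x y \<longleftrightarrow> adjacent T x y \<and> x \<in> S \<and> y \<in> S"
  unfolding adjacent_def induced_subgraph_def by auto

lemma verts_induced [simp]: "verts (induced_subgraph T S) = verts T \<inter> S"
  unfolding induced_subgraph_def by simp

lemma simple_induced: "simple_graph T \<Longrightarrow> simple_graph (induced_subgraph T S)"
  unfolding simple_graph_def induced_subgraph_def by auto

text \<open>Cuts off a piece \<open>H\<close> whose only link to the rest is \<open>uv\<close>.
  Cycles of the remainder are cycles of \<open>T\<close>; connectedness follows by contracting
  \<open>H\<close> to \<open>u\<close>.\<close>

lemma detach: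
  fixes T H :: "'a ugraph" and u v :: 'a
  defines "G \<equiv> induced_subgraph T (verts T - verts H)"
  assumes T: "tree T" and H: "simple_graph H" "verts H \<subseteq> verts T"
    and uv: "u \<in> verts T" "u \<notin> verts H" "v \<in> verts H"
    and "\<forall>x\<in>verts H. \<forall>y. adjacent T x y \<longleftrightarrow> adjacent H x y \<or> x = v \<and> y = u"
  shows "edge_sum G H u v" "T = graph_sum G H u v" "tree G" "card (verts G) < card (verts T)"
proof -
  have T': "simple_graph T" "connected_graph T" "\<nexists>c. is_cycle T c"
    using T unfolding tree_def by auto
  have adj: "x \<in> verts H \<Longrightarrow> adjacent T x y \<longleftrightarrow> adjacent H x y \<or> x = v \<and> y = u" for x y
    using assms(8) by blast
  have vG: "verts G = verts T - verts H" unfolding G_def by auto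
  have sG: "simple_graph G" unfolding G_def using simple_induced T' by blast
  show E: "edge_sum G H u v" using sG H uv vG by (intro edge_sumI) auto
  interpret edge_sum G H u v by (rule E)
  have adjG: "adjacent G x y \<longleftrightarrow> adjacent T x y \<and> x \<notin> verts H \<and> y \<notin> verts H" for x y
    unfolding G_def adjacent_induced using adjacentD[OF T'(1)] by blast
  show eq: "T = graph_sum G H u v"
  proof (rule ugraph_eqI[OF T'(1) simple_sum])
    show "verts T = verts GH" unfolding verts_sum vG using H by blast
    fix x y
    show "adjacent T x y \<longleftrightarrow> adjacent GH x y"
    proof (cases "x \<in> verts H")
      case True
      then show ?thesis using adj adjacent_sum_H by simp
    next
      case x: False
      show ?thesis
      proof (cases "y \<in> verts H")
        case True
        then have "adjacent T y x \<longleftrightarrow> adjacent GH y x" using adj adjacent_sum_H by simp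
        then show ?thesis by (simp add: adjacent_sym)
      next
        case False
        then show ?thesis
          using x uv adjacentD[OF H(1)] unfolding adjacent_sum adjG by blast
      qed
    qed
  qed
  show "card (verts G) < card (verts T)"
    unfolding vG using uv H T'(1) unfolding simple_graph_def by (intro psubset_card_mono) auto
  \<comment> \<open>The contraction: every edge meeting \<open>H\<close> collapses to the point
    \<open>u\<close>, since the only edge leaving \<open>H\<close> ends there, and all other edges
    stay in \<open>G\<close>.\<close>
  define f where "f x = (if x \<in> verts H then u else x)" for x
  have step: "(adjacent G)\<^sup>*\<^sup>* (f x) (f y)" if "adjacent T x y" for x y
  proof (cases "x \<in> verts H \<or> y \<in> verts H")
    case True
    then have "f x = f y"
      using that adj[of x y] adj[of y x] adjacentD[OF H(1)] adjacent_sym[of T x y] unfolding f_def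
      by auto
    then show ?thesis by simp
  next
    case False
    then show ?thesis using that unfolding f_def by (simp add: adjG r_into_rtranclp)
  qed
  have path: "(adjacent G)\<^sup>*\<^sup>* (f x) (f y)" if "(adjacent T)\<^sup>*\<^sup>* x y" for x y
    using that
  proof induction
    case (step y z)
    then show ?case using \<open>\<And>x y. adjacent T x y \<Longrightarrow> (adjacent G)\<^sup>*\<^sup>* (f x) (f y)\<close>
      by (meson rtranclp_trans)
  qed simp
  have "(adjacent G)\<^sup>*\<^sup>* x y" if "x \<in> verts G" "y \<in> verts G" for x y
  proof -
    have "(adjacent T)\<^sup>*\<^sup>* x y" using that T'(2) vG unfolding connected_graph_def by blast
    from path[OF this] show ?thesis using that vG unfolding f_def by simp
  qed
  then have "connected_graph G" unfolding connected_graph_def using ends by blast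
  moreover have "\<not> is_cycle G c" for c
  proof
    assume "is_cycle G c"
    then have "is_cycle T c"
      unfolding is_cycle_def adjG using vG by (auto elim!: successively_mono)
    with T'(3) show False by blast
  qed
  ultimately show "tree G" unfolding tree_def using sG by blast
qed

text \<open>Only \<open>w\<close> can dominate \<open>x\<close>. With \<open>w\<close> in the set,
  \<open>x\<close> covers no further edge, so a minimum cover omits it.\<close>

lemma gamma_t_tau_leaf:
  assumes T: "simple_graph T" and S: "gamma_t_tau_set T S"
    and leaf: "\<And>y. adjacent T x y \<longleftrightarrow> y = w"
  shows "w \<in> S" "x \<notin> S"
proof -
  have xw: "x \<in> verts T" "x \<noteq> w" using adjacentD[OF T] leaf by blast+
  have S': "S \<subseteq> verts T" "\<And>x. x \<in> verts T \<Longrightarrow> \<exists>y\<in>S. adjacent T x y"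
    "\<And>x y. adjacent T x y \<Longrightarrow> x \<in> S \<or> y \<in> S"
    "\<And>X. vertex_cover T X \<Longrightarrow> card S \<le> card X"
    using S unfolding gamma_t_tau_set_def gamma_t_set_iff tau_set_iff
      vertex_cover_adjacent[OF T] total_dominating_set_adjacent[OF T] by blast+
  show w: "w \<in> S" using S'(2)[OF xw(1)] by (simp add: leaf)
  show "x \<notin> S"
  proof
    assume x: "x \<in> S"
    have "p \<in> S - {x} \<or> q \<in> S - {x}" if pq: "adjacent T p q" for p q
    proof -
      have "q = w" if "p = x" using that pq leaf by simp
      moreover have "p = w" if "q = x" using that pq leaf adjacent_sym[of T p q] by simp
      ultimately show ?thesis using S'(3)[OF pq] w xw by auto
    qed
    then have "vertex_cover T (S - {x})" unfolding vertex_cover_adjacent[OF T] using S'(1) by blast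
    from S'(4)[OF this] show False
      using x S'(1) T card_Diff1_less finite_subset unfolding simple_graph_def by (metis not_less)
  qed
qed

section \<open>Criteria for undoing each operation\<close>

definition reducible :: "'a ugraph \<Rightarrow> bool" where
  "reducible T \<longleftrightarrow> (\<exists>G S. tree G \<and> gamma_t_tau_set G S \<and> card (verts G) < card (verts T) \<and>
    (op1 G T \<or> op2 G T \<or> op3 G T \<or> op4 G T))"

lemma reducibleI:
  assumes "tree G" "gamma_t_tau_set G S" "card (verts G) < card (verts T)"
    "op1 G T \<or> op2 G T \<or> op3 G T \<or> op4 G T"
  shows "reducible T"
  unfolding reducible_def by (rule exI[of _ G], rule exI[of _ S]) (intro conjI assms)

text \<open>Since \<open>a\<close> is outside \<open>S\<close>, it does not help to dominate
  \<open>u\<close>, so \<open>S\<close> restricts to a total dominating set; and covering the edge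
  \<open>au\<close> puts \<open>u\<close> into \<open>S\<close>.\<close>

lemma reducible_op1:
  assumes T: "tree T" and S: "gamma_t_tau_set T S" and d: "distinct [a, b, c, d]" "u \<notin> {a, b, c, d}"
    and adj: "\<And>y. adjacent T a y \<longleftrightarrow> y = b \<or> y = u" "\<And>y. adjacent T b y \<longleftrightarrow> y = a \<or> y = c"
      "\<And>y. adjacent T c y \<longleftrightarrow> y = b \<or> y = d" "\<And>y. adjacent T d y \<longleftrightarrow> y = c"
    and in_S: "a \<notin> S" "b \<in> S" "c \<in> S"
  shows "reducible T"
proof -
  have T': "simple_graph T" using T unfolding tree_def by simp
  have V: "a \<in> verts T" "b \<in> verts T" "c \<in> verts T" "d \<in> verts T" "u \<in> verts T"
    using adj adjacentD[OF T'] by blast+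
  let ?H = "path4 a b c d"
  let ?G = "induced_subgraph T (verts T - verts ?H)"
  have H: "simple_graph ?H" by (rule simple_path4[OF d(1)])
  have adjH: "\<forall>x\<in>verts ?H. \<forall>y. adjacent T x y \<longleftrightarrow> adjacent ?H x y \<or> x = a \<and> y = u"
    using d unfolding adjacent_path4 by (auto simp: adj)
  have "verts ?H \<subseteq> verts T" "u \<notin> verts ?H" "a \<in> verts ?H" using V d by auto
  note D = detach[OF T H this(1) V(5) this(2,3) adjH]
  interpret edge_sum ?G ?H u a by (rule D(1))
  have GH: "GH = T" by (rule D(2)[symmetric])
  have s: "total_dominating_set GH S" "vertex_cover GH S"
    using S unfolding GH gamma_t_tau_set_def gamma_t_set_iff tau_set_iff by auto
  have u: "u \<in> S" using s(2) in_S unfolding vertex_cover_sum by blast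
  have "card {b, c} \<le> card (S \<inter> verts ?H)" using in_S by (intro card_mono) auto
  then have c: "2 \<le> card (S \<inter> verts ?H)" using d by simp
  have g: "gamma_t_tau_set ?G (S \<inter> verts ?G)"
  proof (rule gamma_t_tau_sumD)
    show "gamma_t_tau_set GH S" unfolding GH by (rule S)
    show "total_dominating_set ?G (S \<inter> verts ?G)"
      using s(1) in_S unfolding total_dominating_sum total_dominating_set_adjacent[OF simple(1)]
      by blast
    fix X assume X: "total_dominating_set ?G X"
    then have "X \<subseteq> verts ?G" unfolding total_dominating_set_iff by simp
    then have "card (X \<union> {b, c}) = card X + 2" using Un_parts(3)[of X "{b, c}"] d by simp
    moreover have "total_dominating_set GH (X \<union> {b, c})"
      by (rule total_dominating_UnI[OF X]) (auto simp: adjacent_path4)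
    ultimately show "\<exists>D'. total_dominating_set GH D' \<and> card D' \<le> card X + card (S \<inter> verts ?H)"
      using c by (intro exI[of _ "X \<union> {b, c}"]) simp
  next
    fix X assume X: "vertex_cover ?G X"
    then have "X \<subseteq> verts ?G" unfolding vertex_cover_def by simp
    \<comment> \<open>A cover of the smaller tree may avoid \<open>u\<close>, so \<open>a\<close> is
      chosen to cover the edge \<open>au\<close>; \<open>{b, c}\<close> would leave it
      uncovered.\<close>
    then have "card (X \<union> {a, c}) = card X + 2" using Un_parts(3)[of X "{a, c}"] d by simp
    moreover have "vertex_cover GH (X \<union> {a, c})"
      by (rule vertex_cover_UnI[OF X]) (auto simp: adjacent_path4 vertex_cover_adjacent[OF H])
    ultimately show "\<exists>X'. vertex_cover GH X' \<and> card X' \<le> card X + card (S \<inter> verts ?H)"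
      using c by (intro exI[of _ "X \<union> {a, c}"]) simp
  qed
  have "op1 ?G T" unfolding op1_def
    by (rule exI[of _ u], rule exI[of _ "S \<inter> verts ?G"], rule exI[of _ ?H], rule exI[of _ a],
      intro conjI g ends disjoint D(2))
      (use u ends leaf_path4[OF d(1)] is_path_graph4_iff d in blast)+
  then show ?thesis by (rule reducibleI[OF D(3) g D(4) disjI1])
qed

text \<open>The second leaf \<open>w\<close> stays behind and keeps \<open>u\<close> indispensable:
  every total dominating set of the smaller tree contains \<open>u\<close>, and covers can be made
  to contain it. Such sets serve for \<open>T\<close> without enlargement.\<close>

lemma reducible_op2:
  assumes T: "tree T" and S: "gamma_t_tau_set T S" and vw: "v \<noteq> w"
    and adj: "\<And>y. adjacent T v y \<longleftrightarrow> y = u" "\<And>y. adjacent T w y \<longleftrightarrow> y = u"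
  shows "reducible T"
proof -
  have T': "simple_graph T" using T unfolding tree_def by simp
  have V: "v \<in> verts T" "w \<in> verts T" "u \<in> verts T" "u \<noteq> v" "u \<noteq> w"
    using adj adjacentD[OF T'] by blast+
  let ?H = "path1 v"
  let ?G = "induced_subgraph T (verts T - verts ?H)"
  have H: "simple_graph ?H" by (rule simple_path1)
  have adjH: "\<forall>x\<in>verts ?H. \<forall>y. adjacent T x y \<longleftrightarrow> adjacent ?H x y \<or> x = v \<and> y = u"
    by (auto simp: adj adjacent_path1)
  have "verts ?H \<subseteq> verts T" "u \<notin> verts ?H" "v \<in> verts ?H" using V by auto
  note D = detach[OF T H this(1) V(3) this(2,3) adjH]
  interpret edge_sum ?G ?H u v by (rule D(1))
  have GH: "GH = T" by (rule D(2)[symmetric])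
  have s: "total_dominating_set GH S" "vertex_cover GH S"
    using S unfolding GH gamma_t_tau_set_def gamma_t_set_iff tau_set_iff by auto
  note in_S = gamma_t_tau_leaf[OF T' S adj(1)]
  have w: "w \<in> verts ?G" "adjacent ?G w y \<longleftrightarrow> y = u" for y
    using vw V adj(2)[of y] unfolding adjacent_induced by auto
  have g: "gamma_t_tau_set ?G (S \<inter> verts ?G)"
  proof (rule gamma_t_tau_sumD)
    show "gamma_t_tau_set GH S" unfolding GH by (rule S)
    show "total_dominating_set ?G (S \<inter> verts ?G)"
      using s(1) in_S unfolding total_dominating_sum total_dominating_set_adjacent[OF simple(1)]
      by blast
    fix X assume X: "total_dominating_set ?G X"
    then obtain y where "y \<in> X" "adjacent ?G w y"
      using w(1) unfolding total_dominating_set_adjacent[OF simple(1)] by blast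
    then have "u \<in> X" using w(2) by simp
    then have "total_dominating_set GH (X \<union> {})" by (intro total_dominating_UnI[OF X]) auto
    then show "\<exists>D'. total_dominating_set GH D' \<and> card D' \<le> card X + card (S \<inter> verts ?H)"
      by (intro exI[of _ X]) simp
  next
    fix X assume X: "vertex_cover ?G X"
    have sub: "X \<subseteq> verts ?G" using X unfolding vertex_cover_def by simp
    have cov: "\<And>x y. adjacent ?G x y \<Longrightarrow> x \<in> X \<or> y \<in> X"
      using X unfolding vertex_cover_adjacent[OF simple(1)] by blast
    \<comment> \<open>A cover without \<open>u\<close> contains \<open>w\<close>, whose only edge is
      \<open>uw\<close>, so \<open>w\<close> can be traded for \<open>u\<close>.\<close>
    have "\<exists>Y. vertex_cover ?G Y \<and> u \<in> Y \<and> card Y \<le> card X"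
    proof (cases "u \<in> X")
      case False
      then have "w \<in> X" using cov[of w u] w(2) by simp
      let ?Y = "insert u (X - {w})"
      have "x \<in> ?Y \<or> y \<in> ?Y" if xy: "adjacent ?G x y" for x y
      proof -
        have "y = u" if "x = w" using that xy w(2) by simp
        moreover have "x = u" if "y = w" using that xy w(2) adjacent_sym[of ?G x y] by simp
        ultimately show ?thesis using cov[OF xy] by blast
      qed
      then have "vertex_cover ?G ?Y"
        unfolding vertex_cover_adjacent[OF simple(1)] using sub ends(1) by blast
      moreover have "finite X" using sub finite_sum(1) finite_subset by blast
      then have "card ?Y \<le> card X" using \<open>w \<in> X\<close> False
        by (metis Diff_iff card_insert_disjoint card_Suc_Diff1 finite_Diff order_refl)
      ultimately show ?thesis by blast
    qed (use X in blast)
    then obtain Y where Y: "vertex_cover ?G Y" "u \<in> Y" "card Y \<le> card X" by blast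
    have "vertex_cover GH (Y \<union> {})"
      using Y by (intro vertex_cover_UnI[OF Y(1)]) (auto simp: adjacent_path1 vertex_cover_adjacent[OF H])
    then show "\<exists>X'. vertex_cover GH X' \<and> card X' \<le> card X + card (S \<inter> verts ?H)"
      using Y by (intro exI[of _ Y]) simp
  qed
  have "op2 ?G T" unfolding op2_def op2_graph_sum
    by (rule exI[of _ u], rule exI[of _ "S \<inter> verts ?G"], rule exI[of _ v],
      intro conjI g ends disjoint D(2)) (use in_S ends in auto)
  then show ?thesis by (rule reducibleI[OF D(3) g D(4) disjI2[OF disjI1]])
qed

text \<open>The neighbor \<open>y\<close> of \<open>u\<close> supports the leaf \<open>z\<close>, so
  it is forced into dominating sets and keeps \<open>u\<close> dominated after the cut. Assumption
  \<open>l\<close> provides two ways to get \<open>u\<close> itself into a total dominating set of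
  the same size: a leaf at \<open>u\<close>, or \<open>y\<close> of degree two.\<close>

lemma reducible_op3:
  assumes T: "tree T" and S: "gamma_t_tau_set T S" and d: "a \<noteq> b" "u \<notin> {a, b}" "y \<noteq> a"
    and adj: "\<And>t. adjacent T a t \<longleftrightarrow> t = b \<or> t = u" "\<And>t. adjacent T b t \<longleftrightarrow> t = a"
      "\<And>t. adjacent T z t \<longleftrightarrow> t = y" "adjacent T u y"
    and l: "(\<exists>l. \<forall>t. adjacent T l t \<longleftrightarrow> t = u) \<or> (\<forall>t. adjacent T y t \<longleftrightarrow> t = z \<or> t = u)"
    and in_S: "a \<in> S" "u \<in> S"
  shows "reducible T"
proof -
  have T': "simple_graph T" using T unfolding tree_def by simp
  have V: "a \<in> verts T" "b \<in> verts T" "u \<in> verts T" "y \<in> verts T" "z \<in> verts T" "y \<noteq> u"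
    using adjacentD[OF T', of a b] adjacentD[OF T', of a u] adjacentD[OF T', of u y]
      adjacentD[OF T', of z y] by (auto simp: adj)
  have yz: "y \<noteq> b" "z \<noteq> a" "z \<noteq> b" "z \<noteq> u" "y \<noteq> z"
  proof -
    have ua: "adjacent T u a" "adjacent T a b" "adjacent T b a" "adjacent T z y"
      using adj(1)[of u] adj(1)[of b] adj(2)[of a] adj(3)[of y] adjacent_sym[of T u a] by simp_all
    show "y \<noteq> z" using adjacentD(3)[OF T' ua(4)] by simp
    show yb: "y \<noteq> b" using adj(2)[of u] adj(4) adjacent_sym[of T u y] d by auto
    show "z \<noteq> a" using adj(3)[of b] ua(2) yb by auto
    show "z \<noteq> b" using adj(3)[of a] ua(3) d by auto
    show "z \<noteq> u" using adj(3)[of a] ua(1) d by auto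
  qed
  let ?H = "path2 a b"
  let ?G = "induced_subgraph T (verts T - verts ?H)"
  have H: "simple_graph ?H" by (rule simple_path2[OF d(1)])
  have adjH: "\<forall>x\<in>verts ?H. \<forall>t. adjacent T x t \<longleftrightarrow> adjacent ?H x t \<or> x = a \<and> t = u"
    using d unfolding adjacent_path2 by (auto simp: adj)
  have "verts ?H \<subseteq> verts T" "u \<notin> verts ?H" "a \<in> verts ?H" using V d by auto
  note D = detach[OF T H this(1) V(3) this(2,3) adjH]
  interpret edge_sum ?G ?H u a by (rule D(1))
  have GH: "GH = T" by (rule D(2)[symmetric])
  have s: "total_dominating_set GH S" "vertex_cover GH S"
    using S unfolding GH gamma_t_tau_set_def gamma_t_set_iff tau_set_iff by auto
  have yS: "y \<in> S" by (rule gamma_t_tau_leaf(1)[OF T' S adj(3)])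
  have G: "y \<in> verts ?G" "z \<in> verts ?G" "adjacent ?G z t \<longleftrightarrow> t = y" "adjacent ?G u y" for t
    using V yz d adj(3)[of t] adj(4) unfolding adjacent_induced by auto
  have y_dom: "y \<in> X" if "\<exists>t\<in>X. adjacent ?G z t" for X using that G(3) by simp
  have "card {a} \<le> card (S \<inter> verts ?H)" using in_S by (intro card_mono) auto
  then have c: "1 \<le> card (S \<inter> verts ?H)" by simp
  have g: "gamma_t_tau_set ?G (S \<inter> verts ?G)"
  proof (rule gamma_t_tau_sumD)
    show "gamma_t_tau_set GH S" unfolding GH by (rule S)
    show "total_dominating_set ?G (S \<inter> verts ?G)"
      using s(1) yS G unfolding total_dominating_sum total_dominating_set_adjacent[OF simple(1)]
      by blast
    fix X assume X: "total_dominating_set ?G X"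
    then have sub: "X \<subseteq> verts ?G" and dom: "\<forall>x\<in>verts ?G. \<exists>y\<in>X. adjacent ?G x y"
      unfolding total_dominating_set_adjacent[OF simple(1)] by blast+
    have "\<exists>Y. total_dominating_set ?G Y \<and> u \<in> Y \<and> card Y \<le> card X"
    proof (cases "u \<in> X")
      case False
      \<comment> \<open>A leaf at \<open>u\<close> survives the cut and would force \<open>u\<close>
        into \<open>X\<close>, so only the second alternative of \<open>l\<close> remains.\<close>
      have "u \<in> X" if l: "\<forall>t. adjacent T l t \<longleftrightarrow> t = u" for l
      proof -
        have "l \<notin> verts ?H" "l \<in> verts T"
          using l adj(1)[of b] adj(2)[of a] d adjacentD(1)[OF T', of l u] by auto
        then have "l \<in> verts ?G" by simp
        then obtain t where "t \<in> X" "adjacent ?G l t" using dom by blast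
        then show ?thesis using l unfolding adjacent_induced by auto
      qed
      then have ady: "adjacent T y t \<longleftrightarrow> t = z \<or> t = u" for t using l False by blast
      obtain t where "t \<in> X" "adjacent ?G y t" using dom G(1) by blast
      then have zX: "z \<in> X" using ady[of t] False unfolding adjacent_induced by auto
      \<comment> \<open>The leaf \<open>z\<close> dominates only \<open>y\<close>, and so does
        \<open>u\<close> among others.\<close>
      let ?Y = "insert u (X - {z})"
      have "\<exists>t\<in>?Y. adjacent ?G x t" if x: "x \<in> verts ?G" for x
      proof (cases "x = y")
        case True
        then show ?thesis using G(4) by (auto simp: adjacent_sym)
      next
        case False
        then have "\<not> adjacent ?G x z" using G(3)[of x] by (simp add: adjacent_sym)
        then show ?thesis using dom x by blast
      qed
      then have "total_dominating_set ?G ?Y"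
        unfolding total_dominating_set_adjacent[OF simple(1)] using sub ends(1) by blast
      moreover have "finite X" using sub finite_sum(1) finite_subset by blast
      then have "card ?Y \<le> card X" using zX False
        by (metis Diff_iff card_insert_disjoint card_Suc_Diff1 finite_Diff order_refl)
      ultimately show ?thesis by blast
    qed (use X in blast)
    then obtain Y where Y: "total_dominating_set ?G Y" "u \<in> Y" "card Y \<le> card X" by blast
    then have "Y \<subseteq> verts ?G" unfolding total_dominating_set_iff by simp
    then have "card (Y \<union> {a}) = card Y + 1" using Un_parts(3)[of Y "{a}"] by simp
    moreover have "total_dominating_set GH (Y \<union> {a})"
      by (rule total_dominating_UnI[OF Y(1)]) (auto simp: adjacent_path2 Y)
    ultimately show "\<exists>D'. total_dominating_set GH D' \<and> card D' \<le> card X + card (S \<inter> verts ?H)"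
      using c Y(3) by (intro exI[of _ "Y \<union> {a}"]) simp
  next
    fix X assume X: "vertex_cover ?G X"
    then have "X \<subseteq> verts ?G" unfolding vertex_cover_def by simp
    then have "card (X \<union> {a}) = card X + 1" using Un_parts(3)[of X "{a}"] by simp
    moreover have "vertex_cover GH (X \<union> {a})"
      by (rule vertex_cover_UnI[OF X]) (auto simp: adjacent_path2 vertex_cover_adjacent[OF H])
    ultimately show "\<exists>X'. vertex_cover GH X' \<and> card X' \<le> card X + card (S \<inter> verts ?H)"
      using c by (intro exI[of _ "X \<union> {a}"]) simp
  qed
  then have gt: "gamma_t_set ?G (S \<inter> verts ?G)" unfolding gamma_t_tau_set_def by simp
  have q: "\<not> quasi_isolated ?G u"
  proof
    assume "quasi_isolated ?G u"
    then obtain X where X: "X \<subseteq> verts ?G" "\<forall>x\<in>verts ?G - {u}. \<exists>y\<in>X. adjacent ?G x y"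
      "card X < card (S \<inter> verts ?G)"
      unfolding quasi_isolated_iff[OF simple(1) gt ends(1)] by blast
    \<comment> \<open>Dominating the leaf \<open>z\<close> takes \<open>y\<close>, and
      \<open>y\<close> dominates \<open>u\<close> as well; hence \<open>X\<close> misses
      nothing.\<close>
    have "y \<in> X" using y_dom X(2) G(2) yz by blast
    then have "total_dominating_set ?G X"
      unfolding total_dominating_set_adjacent[OF simple(1)] using X(1,2) G(4) by blast
    then show False using gt X(3) unfolding gamma_t_set_iff by fastforce
  qed
  have "op3 ?G T" unfolding op3_def
    by (rule exI[of _ u], rule exI[of _ "S \<inter> verts ?G"], rule exI[of _ ?H], rule exI[of _ a],
      intro conjI g ends disjoint D(2) q)
      (use in_S ends is_path_graph2_iff d in blast)+
  then show ?thesis by (rule reducibleI[OF D(3) g D(4) disjI2[OF disjI2[OF disjI1]]])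
qed

text \<open>The vertex \<open>w\<close> dominates \<open>u\<close> after the cut. A small set
  missing only \<open>u\<close> would, together with \<open>b\<close> and \<open>c\<close>, be a
  total dominating set of \<open>T\<close> smaller than \<open>S\<close>; so \<open>u\<close> is not
  quasi-isolated.\<close>

lemma reducible_op4:
  assumes T: "tree T" and S: "gamma_t_tau_set T S" and d: "distinct [a, b, c, d]" "u \<notin> {a, b, c, d}"
    and adj: "\<And>y. adjacent T a y \<longleftrightarrow> y = b" "\<And>y. adjacent T b y \<longleftrightarrow> y = a \<or> y = c \<or> y = u"
      "\<And>y. adjacent T c y \<longleftrightarrow> y = b \<or> y = d" "\<And>y. adjacent T d y \<longleftrightarrow> y = c"
    and in_S: "b \<in> S" "c \<in> S" and w: "w \<in> S" "w \<noteq> b" "adjacent T u w"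
  shows "reducible T"
proof -
  have T': "simple_graph T" using T unfolding tree_def by simp
  have V: "a \<in> verts T" "b \<in> verts T" "c \<in> verts T" "d \<in> verts T" "u \<in> verts T" "w \<in> verts T"
    using adjacentD[OF T', of a b] adjacentD[OF T', of c d] adjacentD[OF T', of b u]
      adjacentD[OF T', of u w] w by (auto simp: adj)
  have wn: "w \<notin> {a, b, c, d}"
    using adj(1)[of u] adj(3)[of u] adj(4)[of u] w d(2) adjacent_sym[of T u w] by auto
  let ?H = "path4 a b c d"
  let ?G = "induced_subgraph T (verts T - verts ?H)"
  have H: "simple_graph ?H" by (rule simple_path4[OF d(1)])
  have adjH: "\<forall>x\<in>verts ?H. \<forall>y. adjacent T x y \<longleftrightarrow> adjacent ?H x y \<or> x = b \<and> y = u"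
    using d unfolding adjacent_path4 by (auto simp: adj)
  have "verts ?H \<subseteq> verts T" "u \<notin> verts ?H" "b \<in> verts ?H" using V d by auto
  note D = detach[OF T H this(1) V(5) this(2,3) adjH]
  interpret edge_sum ?G ?H u b by (rule D(1))
  have GH: "GH = T" by (rule D(2)[symmetric])
  have s: "total_dominating_set GH S" "vertex_cover GH S" "S \<subseteq> verts GH"
    "\<And>X. total_dominating_set GH X \<Longrightarrow> card S \<le> card X"
    using S unfolding GH gamma_t_tau_set_def gamma_t_set_iff tau_set_iff vertex_cover_def by auto
  have G: "w \<in> S \<inter> verts ?G" "adjacent ?G u w"
    using V w wn d(2) unfolding adjacent_induced by auto
  have "card {b, c} \<le> card (S \<inter> verts ?H)" using in_S by (intro card_mono) auto
  then have c: "2 \<le> card (S \<inter> verts ?H)" using d by simp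
  \<comment> \<open>Stated for sets that may miss \<open>u\<close>, which \<open>b\<close>
    dominates, so that it serves both minimality and the quasi-isolation argument.\<close>
  have ext: "total_dominating_set GH (X \<union> {b, c})" "card (X \<union> {b, c}) = card X + 2"
    if "X \<subseteq> verts ?G" "\<forall>x\<in>verts ?G - {u}. \<exists>y\<in>X. adjacent ?G x y" for X
  proof -
    have "{b, c} \<subseteq> verts ?H" by simp
    note U = Un_parts[OF that(1) this]
    show "card (X \<union> {b, c}) = card X + 2" using U(3) d by simp
    have "(\<exists>y\<in>X. adjacent ?G x y) \<or> x = u" if "x \<in> verts ?G" for x
      using that \<open>\<forall>x\<in>verts ?G - {u}. \<exists>y\<in>X. adjacent ?G x y\<close> by blast
    then show "total_dominating_set GH (X \<union> {b, c})"
      unfolding total_dominating_sum U(1,2) using that(1)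
      by (intro conjI ballI) (auto simp: adjacent_path4)
  qed
  have g: "gamma_t_tau_set ?G (S \<inter> verts ?G)"
  proof (rule gamma_t_tau_sumD)
    show "gamma_t_tau_set GH S" unfolding GH by (rule S)
    show "total_dominating_set ?G (S \<inter> verts ?G)"
      using s(1) G unfolding total_dominating_sum total_dominating_set_adjacent[OF simple(1)]
      by blast
    fix X assume X: "total_dominating_set ?G X"
    then have "X \<subseteq> verts ?G" "\<forall>x\<in>verts ?G - {u}. \<exists>y\<in>X. adjacent ?G x y"
      unfolding total_dominating_set_adjacent[OF simple(1)] by blast+
    from ext[OF this]
    show "\<exists>D'. total_dominating_set GH D' \<and> card D' \<le> card X + card (S \<inter> verts ?H)"
      using c by (intro exI[of _ "X \<union> {b, c}"]) simp
  next
    fix X assume X: "vertex_cover ?G X"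
    then have "X \<subseteq> verts ?G" unfolding vertex_cover_def by simp
    then have "card (X \<union> {b, c}) = card X + 2" using Un_parts(3)[of X "{b, c}"] d by simp
    moreover have "vertex_cover GH (X \<union> {b, c})"
      by (rule vertex_cover_UnI[OF X]) (auto simp: adjacent_path4 vertex_cover_adjacent[OF H])
    ultimately show "\<exists>X'. vertex_cover GH X' \<and> card X' \<le> card X + card (S \<inter> verts ?H)"
      using c by (intro exI[of _ "X \<union> {b, c}"]) simp
  qed
  then have gt: "gamma_t_set ?G (S \<inter> verts ?G)" unfolding gamma_t_tau_set_def by simp
  have q: "\<not> quasi_isolated ?G u"
  proof
    assume "quasi_isolated ?G u"
    then obtain X where X: "X \<subseteq> verts ?G" "\<forall>x\<in>verts ?G - {u}. \<exists>y\<in>X. adjacent ?G x y"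
      "card X < card (S \<inter> verts ?G)"
      unfolding quasi_isolated_iff[OF simple(1) gt ends(1)] by blast
    from s(4)[OF ext(1)[OF X(1,2)]] ext(2)[OF X(1,2)] card_split[OF s(3)] c X(3)
    show False by linarith
  qed
  have "op4 ?G T" unfolding op4_def
    by (rule exI[of _ u], rule exI[of _ ?H], rule exI[of _ b],
      intro conjI g ends disjoint D(2) q)
      (use support_path4[OF d(1)] is_path_graph4_iff d in blast)+
  then show ?thesis by (rule reducibleI[OF D(3) g D(4) disjI2[OF disjI2[OF disjI2]]])
qed

section \<open>Longest walks\<close>

text \<open>In a tree a walk without immediate reversals is a path. Working with such walks makes it a
  local condition that a longest path may be rerouted into another branch of the same depth.\<close>

fun nb_walk :: "'a ugraph \<Rightarrow> 'a list \<Rightarrow> bool" where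
  "nb_walk G (x # y # z # p) \<longleftrightarrow> adjacent G x y \<and> x \<noteq> z \<and> nb_walk G (y # z # p)"
| "nb_walk G [x, y] \<longleftrightarrow> adjacent G x y"
| "nb_walk G [x] \<longleftrightarrow> x \<in> verts G"
| "nb_walk G [] \<longleftrightarrow> True"

lemma nb_walk_successively: "nb_walk G p \<Longrightarrow> successively (adjacent G) p"
  by (induction G p rule: nb_walk.induct) auto

lemma nb_walk_verts: "simple_graph G \<Longrightarrow> nb_walk G p \<Longrightarrow> set p \<subseteq> verts G"
  by (induction G p rule: nb_walk.induct) (auto dest: adjacentD)

lemma nb_walk_tl: "simple_graph G \<Longrightarrow> nb_walk G (x # p) \<Longrightarrow> nb_walk G p"
  by (cases "(G, x # p)" rule: nb_walk.cases) (auto dest: adjacentD)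

text \<open>If the head recurs, the stretch before its recurrence has distinct vertices by induction
  and closes up to a cycle.\<close>

lemma nb_walk_distinct:
  assumes G: "simple_graph G" "\<nexists>c. is_cycle G c"
  shows "nb_walk G p \<Longrightarrow> distinct p"
proof (induction p)
  case (Cons x q)
  have "x \<notin> set q"
  proof
    assume "x \<in> set q"
    then obtain as bs where q: "q = as @ x # bs" by (meson split_list)
    have suc: "successively (adjacent G) ((x # as) @ x # bs)"
      using nb_walk_successively[OF Cons.prems] q by simp
    then have suc': "successively (adjacent G) (x # as)" "adjacent G (last (x # as)) x"
      unfolding successively_append_iff by auto
    have dis: "distinct (x # as)" using Cons nb_walk_tl[OF G(1)] q by fastforce
    have V: "set (x # as) \<subseteq> verts G" using nb_walk_verts[OF G(1) Cons.prems] q by auto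
    \<comment> \<open>An empty \<open>as\<close> would give a loop at \<open>x\<close>, a single
      \<open>y\<close> the reversal \<open>x y x\<close>; so the closed stretch has at least three
      vertices.\<close>
    have "as \<noteq> []" using suc'(2) adjacentD(3)[OF G(1), of x x] by auto
    moreover have "as \<noteq> [y]" for y using Cons.prems q by auto
    ultimately have "length (x # as) \<ge> 3" by (cases as rule: remdups_adj.cases) auto
    then have "is_cycle G (x # as)" unfolding is_cycle_def using suc' dis V by simp
    with G(2) show False by blast
  qed
  then show ?case using Cons nb_walk_tl[OF G(1)] by simp
qed simp

definition longest :: "'a ugraph \<Rightarrow> 'a list \<Rightarrow> bool" where
  "longest G p \<longleftrightarrow> nb_walk G p \<and> (\<forall>q. nb_walk G q \<longrightarrow> length q \<le> length p)"

lemma longest_exists: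
  assumes G: "tree G" and p: "nb_walk G p"
  shows "\<exists>q. longest G q \<and> length p \<le> length q"
proof -
  have G': "simple_graph G" "\<nexists>c. is_cycle G c" using G unfolding tree_def by auto
  have "length q \<le> card (verts G)" if "nb_walk G q" for q
    using nb_walk_distinct[OF G' that] nb_walk_verts[OF G'(1) that] G'(1) distinct_card[of q]
      card_mono[of "verts G" "set q"] unfolding simple_graph_def by simp
  then have "\<forall>q. nb_walk G q \<longrightarrow> length q < Suc (card (verts G))" by (simp add: less_Suc_eq_le)
  from ex_has_greatest_nat[of "nb_walk G", OF p this]
  obtain q where "nb_walk G q" "\<forall>r. nb_walk G r \<longrightarrow> length r \<le> length q" by blast
  then show ?thesis using p unfolding longest_def by blast
qed

text \<open>Lets the beginning of a longest walk be rerouted into another branch of equal depth, to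
  which all facts on longest walks then apply.\<close>

lemma longest_same_length: "longest G p \<Longrightarrow> nb_walk G q \<Longrightarrow> length q = length p \<Longrightarrow> longest G q"
  unfolding longest_def by simp

text \<open>A second neighbor of \<open>x\<close> could be put in front of the walk.\<close>

lemma longest_leaf:
  assumes "longest G (x # y # p)"
  shows "adjacent G x t \<longleftrightarrow> t = y"
proof
  have w: "nb_walk G (x # y # p)" using assms unfolding longest_def by simp
  then have xy: "adjacent G x y" by (cases p) auto
  then show "adjacent G x t" if "t = y" using that by simp
  show "t = y" if "adjacent G x t"
  proof (rule ccontr)
    assume "t \<noteq> y"
    then have "nb_walk G (t # x # y # p)" using that w by (simp add: adjacent_sym)
    then show False using assms unfolding longest_def by fastforce
  qed
qed

section \<open>Trees on which no operation can be undone\<close>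

locale irreducible_tree =
  fixes T :: "'a ugraph" and S :: "'a set"
  assumes tree: "tree T" and S: "gamma_t_tau_set T S" and irreducible: "\<not> reducible T"
begin

abbreviation adj :: "'a \<Rightarrow> 'a \<Rightarrow> bool" where "adj \<equiv> adjacent T"

lemma simple: "simple_graph T" and acyclic: "\<nexists>c. is_cycle T c"
  using tree unfolding tree_def by auto

lemma S_subset: "S \<subseteq> verts T"
  using S unfolding gamma_t_tau_set_def tau_set_def vertex_cover_def by blast

lemma S_dominates: "x \<in> verts T \<Longrightarrow> \<exists>y\<in>S. adj x y"
  using S unfolding gamma_t_tau_set_def gamma_t_set_def total_dominating_set_adjacent[OF simple]
  by blast

lemma S_covers: "adj x y \<Longrightarrow> x \<in> S \<or> y \<in> S"
  using S unfolding gamma_t_tau_set_def tau_set_def vertex_cover_adjacent[OF simple] by blast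

lemma finite_S: "finite S"
  using S_subset simple finite_subset unfolding simple_graph_def by blast

lemma not_dominating:
  assumes "D \<subset> S"
  obtains x where "x \<in> verts T" "\<And>y. y \<in> D \<Longrightarrow> \<not> adj x y"
proof -
  have "card D < card S" using finite_S assms by (rule psubset_card_mono)
  then have "\<not> total_dominating_set T D"
    using S unfolding gamma_t_tau_set_def gamma_t_set_iff by fastforce
  then show ?thesis
    using that assms S_subset unfolding total_dominating_set_adjacent[OF simple] by blast
qed

lemma not_covering:
  assumes "X \<subseteq> verts T" "card X < card S"
  obtains x y where "adj x y" "x \<notin> X" "y \<notin> X"
proof -
  have "\<not> vertex_cover T X" using assms(2) S unfolding gamma_t_tau_set_def tau_set_iff by fastforce
  then show ?thesis using that assms(1) unfolding vertex_cover_adjacent[OF simple] by blast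
qed

lemma leaf_unique:
  assumes "\<And>y. adj v y \<longleftrightarrow> y = u" "\<And>y. adj w y \<longleftrightarrow> y = u"
  shows "v = w"
  using reducible_op2[OF tree S _ assms] irreducible by blast

lemma S_leaf:
  assumes "\<And>y. adj x y \<longleftrightarrow> y = w"
  shows "w \<in> S" "x \<notin> S"
  using gamma_t_tau_leaf[OF simple S assms] by simp_all

lemma adj_neq: "adj x y \<Longrightarrow> x \<noteq> y"
  by (rule adjacentD(3)[OF simple])

text \<open>Any neighbor of \<open>x1\<close> besides \<open>x2\<close> can replace
  \<open>x0\<close> as the start, so it is a leaf too, and \<open>x1\<close> has only one
  leaf.\<close>

lemma longest_second:
  assumes "longest T (x0 # x1 # x2 # p)"
  shows "adj x1 t \<longleftrightarrow> t = x0 \<or> t = x2"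
proof
  have w: "nb_walk T (x0 # x1 # x2 # p)" using assms unfolding longest_def by simp
  then have "nb_walk T (x1 # x2 # p)" and xy: "adj x1 x0" by (simp_all add: adjacent_sym)
  then have "adj x1 x2" by (cases p) auto
  note xy = xy this
  then show "adj x1 t" if "t = x0 \<or> t = x2" using that by auto
  show "t = x0 \<or> t = x2" if "adj x1 t"
  proof (cases "t = x2")
    case False
    then have "nb_walk T (t # x1 # x2 # p)" using that w by (simp add: adjacent_sym)
    then have "longest T (t # x1 # x2 # p)" using longest_same_length[OF assms] by simp
    from leaf_unique[OF longest_leaf[OF this] longest_leaf[OF assms]] show ?thesis ..
  qed simp
qed

lemma longest_S:
  assumes "longest T (x0 # x1 # x2 # p)"
  shows "x0 \<notin> S" "x1 \<in> S" "x2 \<in> S"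
proof -
  show x: "x0 \<notin> S" "x1 \<in> S" using S_leaf longest_leaf[OF assms] by blast+
  then obtain y where "y \<in> S" "adj x1 y" using S_dominates S_subset by blast
  then show "x2 \<in> S" using longest_second[OF assms] x(1) by auto
qed

lemma longest_third:
  assumes L: "longest T (x0 # x1 # x2 # x3 # p)"
  shows "adj x2 t \<longleftrightarrow> t = x1 \<or> t = x3"
proof
  have w: "nb_walk T (x0 # x1 # x2 # x3 # p)" using L unfolding longest_def by simp
  have dist: "distinct (x0 # x1 # x2 # x3 # p)" by (rule nb_walk_distinct[OF simple acyclic w])
  have w': "nb_walk T (x2 # x3 # p)" "adj x0 x1" "adj x1 x2" using w by auto
  then have "adj x2 x3" by (cases p) auto
  note path = this w'
  then show "adj x2 t" if "t = x1 \<or> t = x3" using that by (auto simp: adjacent_sym)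
  note N0 = longest_leaf[OF L] and N1 = longest_second[OF L] and inS = longest_S[OF L]
  \<comment> \<open>A neighbor \<open>y\<close> that is no leaf starts a branch as deep as the one
    through \<open>x1\<close>. The walk rerouted through it is longest, so \<open>y\<close> has
    degree two and the second alternative of \<open>reducible_op3\<close> applies.\<close>
  have leaf: "adj y r \<longleftrightarrow> r = x2" if y: "adj x2 y" "y \<noteq> x1" "y \<noteq> x3" for y r
  proof (rule ccontr)
    assume "\<not> (adj y r \<longleftrightarrow> r = x2)"
    then have r: "adj y r" "r \<noteq> x2" using y by (auto simp: adjacent_sym)
    then have "nb_walk T (r # y # x2 # x3 # p)" using y path by (simp add: adjacent_sym)
    then have L': "longest T (r # y # x2 # x3 # p)" using longest_same_length[OF L] by simp
    have "reducible T"
      by (rule reducible_op3[OF tree S, of x1 x0 x2 y r])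
        (use dist y inS N0 N1 longest_leaf[OF L'] longest_second[OF L'] in auto)
    with irreducible show False ..
  qed
  show "t = x1 \<or> t = x3" if t: "adj x2 t"
  proof (rule ccontr)
    assume "\<not> (t = x1 \<or> t = x3)"
    with t have ty: "t \<noteq> x1" "t \<noteq> x3" by auto
    note lt = leaf[OF t ty]
    have N2: "adj x2 y \<longleftrightarrow> y = t \<or> y = x1 \<or> y = x3" for y
      using leaf_unique[OF leaf lt, of y] t path by (auto simp: adjacent_sym)
    have dt: "distinct [t, x2, x1, x0]" "x3 \<notin> {t, x2, x1, x0}"
      using dist ty lt[of x1] N0 adj_neq[OF t] by auto
    \<comment> \<open>Otherwise the path \<open>t\<close>, \<open>x2\<close>, \<open>x1\<close>,
      \<open>x0\<close> hanging at \<open>x3\<close> could be removed by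
      \<open>reducible_op4\<close>.\<close>
    have no_w: "w \<notin> S" if "adj x3 w" "w \<noteq> x2" for w
    proof
      assume "w \<in> S"
      have "reducible T"
        by (rule reducible_op4[OF tree S dt, of w])
          (use N0 N1 N2 lt inS that \<open>w \<in> S\<close> in auto)
      with irreducible show False ..
    qed
    \<comment> \<open>Outside \<open>S\<close>, \<open>x3\<close> would have all its neighbors in
      \<open>S\<close>; only \<open>x2\<close> is available, which makes \<open>x3\<close> a second
      leaf at \<open>x2\<close>.\<close>
    have x3: "x3 \<in> S"
    proof (rule ccontr)
      assume "x3 \<notin> S"
      then have "adj x3 y \<longleftrightarrow> y = x2" for y
        using S_covers[of x3 y] no_w[of y] path(1) by (auto simp: adjacent_sym)
      from leaf_unique[OF this lt] ty show False by simp
    qed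
    \<comment> \<open>Some vertex \<open>x\<close> has \<open>x3\<close> as its only neighbor in
      \<open>S\<close>. By \<open>no_w\<close> it lies outside \<open>S\<close>, so all its
      neighbors are in \<open>S\<close>, and \<open>x\<close> is a leaf at \<open>x3\<close>. With
      the leaf \<open>t\<close> at \<open>x2\<close>, the first alternative of
      \<open>reducible_op3\<close> applies.\<close>
    have "S - {x3} \<subset> S" using x3 by blast
    then obtain x where x: "x \<in> verts T" "\<And>y. y \<in> S - {x3} \<Longrightarrow> \<not> adj x y"
      using not_dominating by blast
    then have xx3: "adj x x3" using S_dominates by blast
    have "x \<noteq> x2" using x(2)[of x1] inS dist path by (auto simp: adjacent_sym)
    then have "x \<notin> S" using no_w xx3 by (simp add: adjacent_sym)
    then have lx: "adj x y \<longleftrightarrow> y = x3" for y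
      using S_covers[of x y] x(2)[of y] xx3 by auto
    have "\<exists>l. \<forall>t. adj l t \<longleftrightarrow> t = x2" using lt by blast
    then have "reducible T"
      by (intro reducible_op3[OF tree S, of x1 x0 x2 x3 x] disjI1)
        (use dist inS N0 N1 lx path in auto)
    with irreducible show False ..
  qed
qed

lemma is_path4: "is_path_graph 4 T"
proof -
  obtain x where "x \<in> verts T" using tree unfolding tree_def connected_graph_def by blast
  then obtain r where r: "r \<in> S" using S_dominates by blast
  then obtain s where s: "s \<in> S" "adj r s" using S_dominates S_subset by blast
  \<comment> \<open>Members of \<open>S\<close> are not leaves, so the edge \<open>rs\<close>
    extends at both ends to a walk on four vertices.\<close>
  obtain a where a: "adj r a" "a \<noteq> s" using S_leaf(2)[of r s] r s by blast
  obtain b where b: "adj s b" "b \<noteq> r" using S_leaf(2)[of s r] s by (metis adjacent_sym)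
  have "nb_walk T [a, r, s, b]" using a b s by (auto simp: adjacent_sym)
  then obtain q where q: "longest T q" "4 \<le> length q" using longest_exists[OF tree] by fastforce
  then obtain x0 x1 x2 x3 p where "q = x0 # x1 # x2 # x3 # p"
    by (auto simp: numeral_eq_Suc Suc_le_length_iff)
  with q have L: "longest T (x0 # x1 # x2 # x3 # p)" by simp
  then have w: "nb_walk T (x0 # x1 # x2 # x3 # p)" unfolding longest_def by simp
  have dist: "distinct (x0 # x1 # x2 # x3 # p)" by (rule nb_walk_distinct[OF simple acyclic w])
  note N0 = longest_leaf[OF L] and N1 = longest_second[OF L] and N2 = longest_third[OF L]
    and inS = longest_S[OF L]
  \<comment> \<open>With \<open>x3\<close> in \<open>S\<close>, both neighbors of \<open>x2\<close>
    would be in the cover and \<open>x2\<close> could be dropped.\<close>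
  have x3: "x3 \<notin> S"
  proof
    assume x3: "x3 \<in> S"
    have "S - {x2} \<subseteq> verts T" "card (S - {x2}) < card S"
      using S_subset inS card_Diff1_less[OF finite_S] by auto
    then obtain y z where yz: "adj y z" "y \<notin> S - {x2}" "z \<notin> S - {x2}" by (rule not_covering)
    then have "y = x2 \<or> z = x2" using S_covers by blast
    then have "adj x2 z \<and> y = x2 \<or> adj x2 y \<and> z = x2" using yz(1) by (auto simp: adjacent_sym)
    then show False using yz N2 inS x3 dist by auto
  qed
  have only_x2: "adj x3 t \<longleftrightarrow> t = x2" for t
  proof (rule ccontr)
    have x32: "adj x3 x2" using N2[of x3] by (simp add: adjacent_sym)
    assume "\<not> (adj x3 t \<longleftrightarrow> t = x2)"
    then have t: "adj x3 t" "t \<noteq> x2" using x32 by auto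
    \<comment> \<open>If the walk ended at \<open>x3\<close>, the neighbor \<open>t\<close> would
      prolong it.\<close>
    obtain x4 p' where p: "p = x4 # p'"
    proof (cases p)
      case Nil
      then have "nb_walk T [x0, x1, x2, x3, t]" using w t by auto
      then show ?thesis using L Nil unfolding longest_def by fastforce
    qed
    have x34: "adj x3 x4" using w p by (cases p') auto
    \<comment> \<open>If \<open>x2\<close> and \<open>x4\<close> were the only neighbors of
      \<open>x3\<close>, the path from \<open>x3\<close> to \<open>x0\<close> could be removed by
      \<open>reducible_op1\<close>.\<close>
    obtain y2 where y2: "adj x3 y2" "y2 \<noteq> x2" "y2 \<noteq> x4"
    proof (rule ccontr)
      assume "\<not> thesis"
      then have "adj x3 t \<longleftrightarrow> t = x2 \<or> t = x4" for t using that x34 x32 by blast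
      then have "reducible T"
        by (intro reducible_op1[OF tree S, of x3 x2 x1 x0 x4])
          (use dist p N0 N1 N2 x3 inS in auto)
      with irreducible show False ..
    qed
    \<comment> \<open>The set \<open>S\<close> itself yields a second deep branch: covering
      \<open>x3 y2\<close> gives \<open>y2\<close>, dominating \<open>y2\<close> gives
      \<open>y1\<close> other than \<open>x3\<close>, and \<open>y1\<close> is no leaf. The walk
      through this branch has the same length, so \<open>y2\<close> has degree two.\<close>
    have y2S: "y2 \<in> S" using S_covers[OF y2(1)] x3 by simp
    then obtain y1 where y1: "y1 \<in> S" "adj y2 y1" using S_dominates S_subset by blast
    obtain y0 where y0: "adj y1 y0" "y0 \<noteq> y2" using S_leaf(2)[of y1 y2] y1 by (metis adjacent_sym)
    have "nb_walk T (x3 # x4 # p')" using w p by simp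
    then have "nb_walk T (y0 # y1 # y2 # x3 # x4 # p')"
      using y0 y1 y2 x3 by (auto simp: adjacent_sym)
    then have "longest T (y0 # y1 # y2 # x3 # x4 # p')" using longest_same_length[OF L] p by simp
    note M2 = longest_third[OF this]
    have y2x1: "y2 \<noteq> x1" using N1[of x3] y2(1) dist by (auto simp: adjacent_sym)
    have y1x2: "y1 \<noteq> x2" using N2[of y2] y1(2) y2x1 adj_neq[OF y2(1)] by (auto simp: adjacent_sym)
    \<comment> \<open>All edges at \<open>x2\<close> and \<open>y2\<close> lead to
      \<open>x1\<close>, \<open>y1\<close> or \<open>x3\<close>, which are all kept or added.
      Trading two vertices for one thus leaves a cover smaller than \<open>S\<close>.\<close>
    let ?X = "insert x3 (S - {x2, y2})"
    have "card (S - {x2, y2}) = card S - 2" "2 \<le> card S"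
      using card_Diff_subset[of "{x2, y2}" S] card_mono[OF finite_S, of "{x2, y2}"] inS y2S y2(2)
      by auto
    then have "card ?X < card S" using x3 finite_S by simp
    moreover have "?X \<subseteq> verts T" using S_subset adjacentD(1)[OF simple x34] by blast
    ultimately obtain y z where yz: "adj y z" "y \<notin> ?X" "z \<notin> ?X" using not_covering by blast
    have "x1 \<in> ?X" "y1 \<in> ?X" using inS y1 y2x1 y1x2 dist adj_neq[OF y1(2)] by auto
    then have "adj x2 z \<Longrightarrow> z \<in> ?X" "adj y2 z \<Longrightarrow> z \<in> ?X" for z using N2 M2 by auto
    moreover have "y \<in> {x2, y2} \<or> z \<in> {x2, y2}" using S_covers[OF yz(1)] yz(2,3) by blast
    ultimately show False using yz adjacent_sym[of T y z] by blast
  qed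
  have "verts T = {x0, x1, x2, x3}"
  proof (intro equalityI subsetI)
    fix y assume y: "y \<in> verts T"
    have x0: "x0 \<in> verts T" using adjacentD(1)[OF simple] N0 by blast
    \<comment> \<open>The four vertices are closed under adjacency, so connectedness admits no
      others.\<close>
    have "(adj)\<^sup>*\<^sup>* x0 y" using tree y x0 unfolding tree_def connected_graph_def by blast
    then show "y \<in> {x0, x1, x2, x3}" by induction (auto simp: N0 N1 N2 only_x2)
  next
    fix y assume "y \<in> {x0, x1, x2, x3}"
    then show "y \<in> verts T" using nb_walk_verts[OF simple w] by auto
  qed
  moreover have d: "distinct [x0, x1, x2, x3]" using dist by simp
  moreover have "adj y z \<longleftrightarrow> adjacent (path4 x0 x1 x2 x3) y z" for y z
  proof (cases "y \<in> {x0, x1, x2, x3}")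
    case True
    then show ?thesis using d unfolding adjacent_path4 by (auto simp: N0 N1 N2 only_x2)
  next
    case False
    then show ?thesis
      using adjacentD(1)[OF simple, of y z] calculation unfolding adjacent_path4 by auto
  qed
  ultimately have "T = path4 x0 x1 x2 x3"
    by (intro ugraph_eqI[OF simple simple_path4]) simp_all
  then show ?thesis unfolding is_path_graph4_iff using d by blast
qed

end

section \<open>Rebuilding a tree from the four-vertex path\<close>

lemma tree_family_path4: "tree T \<Longrightarrow> is_path_graph 4 T \<Longrightarrow> T \<in> tree_family"
  unfolding tree_family_def by (intro CollectI exI[of _ "[T]"]) simp

lemma tree_family_op:
  assumes G: "G \<in> tree_family" and T: "tree T" and op: "op1 G T \<or> op2 G T \<or> op3 G T \<or> op4 G T"
  shows "T \<in> tree_family"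
proof -
  obtain Ts where Ts: "Ts \<noteq> []" "\<forall>T\<in>set Ts. tree T" "is_path_graph 4 (hd Ts)" "last Ts = G"
    and ops: "\<And>i. Suc i < length Ts \<Longrightarrow>
      op1 (Ts ! i) (Ts ! Suc i) \<or> op2 (Ts ! i) (Ts ! Suc i) \<or>
      op3 (Ts ! i) (Ts ! Suc i) \<or> op4 (Ts ! i) (Ts ! Suc i)"
    using G unfolding tree_family_def by blast
  let ?Ts = "Ts @ [T]"
  have "op1 (?Ts ! i) (?Ts ! Suc i) \<or> op2 (?Ts ! i) (?Ts ! Suc i) \<or>
      op3 (?Ts ! i) (?Ts ! Suc i) \<or> op4 (?Ts ! i) (?Ts ! Suc i)" if i: "Suc i < length ?Ts" for i
  proof (cases "Suc i < length Ts")
    case True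
    then show ?thesis using ops[of i] by (simp add: nth_append)
  next
    case False
    then have "i = length Ts - 1" "Suc i = length Ts" using i by auto
    then have "?Ts ! i = G" "?Ts ! Suc i = T" using Ts(1,4) by (auto simp: nth_append last_conv_nth)
    then show ?thesis using op by simp
  qed
  then show ?thesis
    unfolding tree_family_def using Ts T by (intro CollectI exI[of _ ?Ts]) simp
qed

text \<open>Undoing an operation shrinks the tree and keeps a common minimum set, so the descent can
  stop only at an irreducible tree, which is the four-vertex path.\<close>

lemma gamma_t_tau_tree_family:
  assumes "tree T" "gamma_t_tau_set T S"
  shows "T \<in> tree_family"
  using assms
proof (induction "card (verts T)" arbitrary: T S rule: less_induct)
  case less
  show ?case
  proof (cases "reducible T")
    case True
    then obtain G R where G: "tree G" "gamma_t_tau_set G R" "card (verts G) < card (verts T)"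
      and op: "op1 G T \<or> op2 G T \<or> op3 G T \<or> op4 G T"
      unfolding reducible_def by (elim exE conjE)
    show ?thesis by (rule tree_family_op[OF less.hyps[OF G(3,1,2)] less.prems(1) op])
  next
    case False
    interpret irreducible_tree T S using less.prems False by unfold_locales
    show ?thesis by (rule tree_family_path4[OF tree is_path4])
  qed
qed

theorem theorem11:
  fixes T :: "'a ugraph"
  assumes "tree T"
  shows "T \<in> tree_family \<longleftrightarrow> (\<exists>S. gamma_t_tau_set T S)"
  using tree_family_gamma_t_tau gamma_t_tau_tree_family[OF assms] by blast

end
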